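(* Let $E/F$ be a quadratic extension of number fields, let $D$ be a central division algebra of degree three over $E$, and let $\alpha$ be an involution of the second kind on $D$ (with respect to $E/F$). Let $SU=\{g\in D^\times\mid \alpha(g)g=1,\ \mathrm{N}_{rd}(g)=1\}$ be the associated special unitary group. Then $SU$ does not contain non-trivial elements of (finite) even order. In particular, there are no reflections in $SU$.
   Context: Let $\tau$ be the non-trivial element of $\mathrm{Gal}(E/F)$. An involution of the second kind on $D$ is a ring anti-automorphism $\alpha:D\to D$ with $\alpha\circ\alpha=\mathrm{id}$ whose restriction to the center $E$ is $\tau$. $\mathrm{N}_{rd}:D\to E$ denotes the reduced norm. A reflection is an element $R\neq 1$ of the group with $R^2=1$. *)

theory Defs
  imports
    "HOL-Algebra.Algebraic_Closure_Type"
    "HOL-Algebra.Multiplicative_Group"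
    "Jordan_Normal_Form.Determinant"
begin

text \<open>
  All fields live as subsets of the carrier of one (in general non-commutative) ring \<open>D\<close>;
  degrees are dimensions in the sense of \<^theory>\<open>HOL-Algebra.Embedded_Algebras\<close>, the smaller field
  acting by left multiplication.
\<close>

text \<open>The image of a ring homomorphism from the rationals is the prime field, so this says that
  \<open>K\<close> has characteristic zero and finite degree over its prime field.\<close>

definition number_subfield :: "'a set \<Rightarrow> ('a, 'b) ring_scheme \<Rightarrow> bool" where
  "number_subfield K D \<longleftrightarrow>
     subfield K D \<and>
     (\<exists>q \<in> Ring.ring_hom (ring_of_type_algebra :: rat ring) (D\<lparr>carrier := K\<rparr>).
        ring.finite_dimension D (range q) K)"

definition quadratic_number_field_extension ::
    "('a, 'b) ring_scheme \<Rightarrow> 'a set \<Rightarrow> 'a set \<Rightarrow> bool" where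
  "quadratic_number_field_extension D E F \<longleftrightarrow>
     number_subfield E D \<and> number_subfield F D \<and> F \<subseteq> E \<and> ring.dimension D 2 F E"

definition galois_automorphisms ::
    "('a, 'b) ring_scheme \<Rightarrow> 'a set \<Rightarrow> 'a set \<Rightarrow> ('a \<Rightarrow> 'a) set" where
  "galois_automorphisms D E F =
     {\<sigma> \<in> ring_iso (D\<lparr>carrier := E\<rparr>) (D\<lparr>carrier := E\<rparr>). \<forall>x\<in>F. \<sigma> x = x}"

definition ring_center :: "('a, 'b) ring_scheme \<Rightarrow> 'a set" where
  "ring_center D = {z \<in> carrier D. \<forall>x \<in> carrier D. z \<otimes>\<^bsub>D\<^esub> x = x \<otimes>\<^bsub>D\<^esub> z}"

definition central_division_algebra :: "('a, 'b) ring_scheme \<Rightarrow> 'a set \<Rightarrow> nat \<Rightarrow> bool" where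
  "central_division_algebra D E n \<longleftrightarrow>
     ring D \<and> Units D = carrier D - {\<zero>\<^bsub>D\<^esub>} \<and>
     subfield E D \<and> ring_center D = E \<and> ring.dimension D (n\<^sup>2) E (carrier D)"

definition ring_antiautomorphism :: "('a, 'b) ring_scheme \<Rightarrow> ('a \<Rightarrow> 'a) \<Rightarrow> bool" where
  "ring_antiautomorphism D \<alpha> \<longleftrightarrow>
     bij_betw \<alpha> (carrier D) (carrier D) \<and> \<alpha> \<one>\<^bsub>D\<^esub> = \<one>\<^bsub>D\<^esub> \<and>
     (\<forall>x \<in> carrier D. \<forall>y \<in> carrier D.
        \<alpha> (x \<oplus>\<^bsub>D\<^esub> y) = \<alpha> x \<oplus>\<^bsub>D\<^esub> \<alpha> y \<and> \<alpha> (x \<otimes>\<^bsub>D\<^esub> y) = \<alpha> y \<otimes>\<^bsub>D\<^esub> \<alpha> x)"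

text \<open>The automorphism \<open>\<tau>\<close> is only relevant on \<open>E\<close>, hence non-triviality is tested there.\<close>

definition involution_second_kind ::
    "('a, 'b) ring_scheme \<Rightarrow> 'a set \<Rightarrow> 'a set \<Rightarrow> ('a \<Rightarrow> 'a) \<Rightarrow> bool" where
  "involution_second_kind D E F \<alpha> \<longleftrightarrow>
     ring_antiautomorphism D \<alpha> \<and> (\<forall>x \<in> carrier D. \<alpha> (\<alpha> x) = x) \<and>
     (\<exists>\<tau> \<in> galois_automorphisms D E F. (\<exists>x\<in>E. \<tau> x \<noteq> x) \<and> (\<forall>x\<in>E. \<alpha> x = \<tau> x))"

text \<open>
  A splitting of \<open>D\<close> over the complex numbers, which become an \<open>E\<close>-algebra via the embedding \<open>\<iota>\<close>.
  The homomorphism \<open>\<phi>\<close> is the restriction to \<open>D\<close> of an isomorphism from the scalar extension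
  of \<open>D\<close> along \<open>\<iota>\<close> onto the \<open>n \<times> n\<close> matrices: the last clause says that the induced
  complex-linear map is onto, which for an algebra of dimension \<open>n\<^sup>2\<close> is the same as bijective.
\<close>

definition complex_splitting ::
    "('a, 'b) ring_scheme \<Rightarrow> 'a set \<Rightarrow> nat \<Rightarrow> ('a \<Rightarrow> complex) \<Rightarrow> ('a \<Rightarrow> complex mat) \<Rightarrow> bool" where
  "complex_splitting D E n \<iota> \<phi> \<longleftrightarrow>
     \<iota> \<in> Ring.ring_hom (D\<lparr>carrier := E\<rparr>) ring_of_type_algebra \<and>
     \<phi> \<in> Ring.ring_hom D (ring_mat TYPE(complex) n ()) \<and>
     (\<forall>e\<in>E. \<phi> e = \<iota> e \<cdot>\<^sub>m 1\<^sub>m n) \<and>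
     (\<forall>M \<in> carrier_mat n n. \<exists>(m::nat) x c. (\<forall>k<m. x k \<in> carrier D) \<and>
        (\<forall>i<n. \<forall>j<n. M $$ (i, j) = (\<Sum>k<m. c k * \<phi> (x k) $$ (i, j))))"

text \<open>The determinant in a splitting is the image of an element of \<open>E\<close> that does not depend on the
  splitting. Complex splittings suffice because the centre \<open>E\<close> is a number field.\<close>

definition reduced_norm :: "('a, 'b) ring_scheme \<Rightarrow> 'a set \<Rightarrow> nat \<Rightarrow> 'a \<Rightarrow> 'a" where
  "reduced_norm D E n d =
     (THE e. e \<in> E \<and> (\<forall>\<iota> \<phi>. complex_splitting D E n \<iota> \<phi> \<longrightarrow> \<iota> e = det (\<phi> d)))"

definition special_unitary ::
    "('a, 'b) ring_scheme \<Rightarrow> 'a set \<Rightarrow> nat \<Rightarrow> ('a \<Rightarrow> 'a) \<Rightarrow> 'a set" where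
  "special_unitary D E n \<alpha> =
     {g \<in> Units D. \<alpha> g \<otimes>\<^bsub>D\<^esub> g = \<one>\<^bsub>D\<^esub> \<and> reduced_norm D E n g = \<one>\<^bsub>D\<^esub>}"

end

theory Submission
  imports Defs
begin

text \<open>
  An element of even order \<open>2 m\<close> in a division ring satisfies \<open>g\<^sup>m = -1\<close>, since \<open>-1\<close> is the only element
  of order two. Because the degree is odd, \<open>-1\<close> has reduced norm \<open>-1\<close>, so \<open>g\<close> cannot have reduced
  norm \<open>1\<close>. What takes work is that the reduced norm is what it should be, namely that \<open>THE\<close> in its
  definition denotes.

  Uniqueness needs a complex splitting. A maximal commuting subset \<open>K\<close> of \<open>D\<close> is its own centralizer,
  hence a subfield, and \<open>[K : E] = [D : K] = 3\<close> by the tower law. Let \<open>K\<close> act on the additive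
  functionals \<open>f\<close> from \<open>K\<close> to the complex numbers by \<open>(x f)(y) = f (x y)\<close>. These commuting operators
  have a common eigenvector \<open>f\<close>, and \<open>x \<mapsto> f x / f 1\<close> is an embedding of \<open>K\<close>. Composed with the matrices
  of right multiplications in a \<open>K\<close>-basis of \<open>D\<close> it yields a homomorphism into the complex \<open>3 \<times> 3\<close>
  matrices, whose image spans by the density theorem.

  Existence: for \<open>g\<close> outside \<open>E\<close> the elements \<open>1, g, g\<^sup>2\<close> are independent over \<open>E\<close>, because a subfield
  of degree two cannot occur in dimension nine, and \<open>g\<^sup>3 = a g\<^sup>2 + b g + e\<close>. In any splitting the images
  of \<open>1, g, g\<^sup>2\<close> remain independent, so comparison with the Cayley-Hamilton identity shows that the
  determinant is the image of \<open>e\<close>.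
\<close>

section \<open>Linear algebra over a subfield\<close>

text \<open>The scalars of \<open>R\<close> come with no action on the complex numbers, so linearity
  over a subfield cannot be demanded here. It is added where an embedding of the scalars is at
  hand.\<close>

definition additive_functional :: "('a, 'b) ring_scheme \<Rightarrow> 'a set \<Rightarrow> ('a \<Rightarrow> complex) \<Rightarrow> bool" where
  "additive_functional R V f \<longleftrightarrow> (\<forall>x\<in>V. \<forall>y\<in>V. f (x \<oplus>\<^bsub>R\<^esub> y) = f x + f y)"

context ring
begin

text \<open>Links the recursive list combinations behind \<open>Span\<close> to indexed sums, which
  can be distributed over products and mapped through additive functionals.\<close>

lemma combine_eq_finsum:
  assumes "length Ks = length Us" "set Ks \<subseteq> carrier R" "set Us \<subseteq> carrier R"
  shows "combine Ks Us = (\<Oplus>i\<in>{..<length Us}. Ks ! i \<otimes> Us ! i)"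
  using assms
proof (induction Ks Us rule: list_induct2)
  case (Cons k Ks u Us)
  have fin: "(\<lambda>i. (k # Ks) ! i \<otimes> (u # Us) ! i) \<in> {..<length (u # Us)} \<rightarrow> carrier R"
    using Cons.prems Cons.hyps by (auto simp: Pi_def nth_Cons' subset_iff)
  have "(\<Oplus>i\<in>{..<length (u # Us)}. (k # Ks) ! i \<otimes> (u # Us) ! i)
    = k \<otimes> u \<oplus> (\<Oplus>i\<in>Suc ` {..<length Us}. (k # Ks) ! i \<otimes> (u # Us) ! i)"
    using fin Cons.prems Cons.hyps
    by (simp add: lessThan_Suc_eq_insert_0 finsum_insert Pi_def)
  also have "(\<Oplus>i\<in>Suc ` {..<length Us}. (k # Ks) ! i \<otimes> (u # Us) ! i)
      = (\<Oplus>i\<in>{..<length Us}. Ks ! i \<otimes> Us ! i)"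
    using fin by (subst finsum_reindex) (auto simp: Pi_def)
  finally show ?case
    using Cons by simp
qed simp

lemma additive_functional_zero:
  assumes "additive_functional R V f" "\<zero> \<in> V"
  shows "f \<zero> = 0"
proof -
  have "f (\<zero> \<oplus> \<zero>) = f \<zero> + f \<zero>"
    using assms unfolding additive_functional_def by blast
  then show ?thesis by simp
qed

lemma additive_functional_finsum:
  assumes "additive_functional R V f" "subgroup V (add_monoid R)" "finite A" "t \<in> A \<rightarrow> V"
  shows "(\<Oplus>i\<in>A. t i) \<in> V \<and> f (\<Oplus>i\<in>A. t i) = (\<Sum>i\<in>A. f (t i))"
  using assms(3,4)
proof (induction A)
  case empty
  then show ?case
    using subgroup.one_closed[OF assms(2)] additive_functional_zero[OF assms(1)] by simp
next
  case (insert a A)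
  then show ?case
    using assms(1) subgroup.m_closed[OF assms(2)] add.subgroupE(1)[OF assms(2)]
    by (auto simp: finsum_insert Pi_def additive_functional_def subset_iff)
qed

text \<open>A span is a chain of line extensions, so a set closed under sums and scalar multiples
  absorbs one generator at a time.\<close>

lemma Span_induct:
  assumes "subfield K R" "set Us \<subseteq> A" "\<zero> \<in> A"
    and "\<And>x y. x \<in> A \<Longrightarrow> y \<in> A \<Longrightarrow> x \<oplus> y \<in> A"
    and "\<And>k x. k \<in> K \<Longrightarrow> x \<in> A \<Longrightarrow> k \<otimes> x \<in> A"
  shows "Span K Us \<subseteq> A"
  using assms(2)
proof (induction Us)
  case (Cons u Us)
  then show ?case
    using assms(4)[OF assms(5)] by (auto simp: line_extension_mem_iff subset_iff)
qed (use assms(3) in simp)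

lemma subfield_zero_one:
  assumes "subfield K R"
  shows "\<zero> \<in> K" "\<one> \<in> K" "K \<subseteq> carrier R"
  using subringE[OF subfieldE(1)[OF assms]] by auto

text \<open>A basis of a left vector space together with its dual basis. Scalars stay to the left of
  the basis vectors, because \<open>K\<close> need not commute with them.\<close>

definition coordinate_system :: "'a set \<Rightarrow> nat \<Rightarrow> 'a set \<Rightarrow> (nat \<Rightarrow> 'a) \<Rightarrow> (nat \<Rightarrow> 'a \<Rightarrow> 'a) \<Rightarrow> bool" where
  "coordinate_system K n E b c \<longleftrightarrow>
    (\<forall>i<n. b i \<in> E) \<and> Span K (map b [0..<n]) = E \<and>
    (\<forall>i<n. \<forall>x\<in>E. c i x \<in> K) \<and> (\<forall>x\<in>E. x = (\<Oplus>i\<in>{..<n}. c i x \<otimes> b i)) \<and>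
    (\<forall>i<n. \<forall>x\<in>E. \<forall>y\<in>E. c i (x \<oplus> y) = c i x \<oplus> c i y) \<and>
    (\<forall>i<n. \<forall>k\<in>K. \<forall>x\<in>E. c i (k \<otimes> x) = k \<otimes> c i x) \<and>
    (\<forall>i<n. \<forall>j<n. c i (b j) = (if i = j then \<one> else \<zero>))"

lemma coordinate_systemD:
  assumes "coordinate_system K n E b c"
  shows "i < n \<Longrightarrow> b i \<in> E" "Span K (map b [0..<n]) = E"
    "i < n \<Longrightarrow> x \<in> E \<Longrightarrow> c i x \<in> K"
    "x \<in> E \<Longrightarrow> x = (\<Oplus>i\<in>{..<n}. c i x \<otimes> b i)"
    "i < n \<Longrightarrow> x \<in> E \<Longrightarrow> y \<in> E \<Longrightarrow> c i (x \<oplus> y) = c i x \<oplus> c i y"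
    "i < n \<Longrightarrow> k \<in> K \<Longrightarrow> x \<in> E \<Longrightarrow> c i (k \<otimes> x) = k \<otimes> c i x"
    "i < n \<Longrightarrow> j < n \<Longrightarrow> c i (b j) = (if i = j then \<one> else \<zero>)"
  using assms unfolding coordinate_system_def by blast+

text \<open>Coordinates are read off from the unique decomposition in a basis. Each law for them is
  then proved by exhibiting a family of scalars with the right sum and appealing to
  uniqueness.\<close>

lemma dimension_coordinates:
  assumes K: "subfield K R" and dim: "dimension n K E"
  obtains b c where "coordinate_system K n E b c"
proof -
  obtain Us where Us: "set Us \<subseteq> carrier R" "independent K Us" "length Us = n" "Span K Us = E"
    using exists_base[OF K dim] by blast
  define b where "b = (\<lambda>i. Us ! i)"
  define c where "c = (\<lambda>i x. (THE Ks. set Ks \<subseteq> K \<and> length Ks = length Us \<and> x = combine Ks Us) ! i)"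
  note Kc = subfield_zero_one[OF K] and Ks = subringE[OF subfieldE(1)[OF K]]
  have Us_b: "map b [0..<n] = Us"
    using Us(3) by (auto simp: b_def intro!: nth_equalityI)
  have EK: "E \<subseteq> carrier R"
    using space_subgroup_props(1)[OF K dim] .
  have bE: "b i \<in> E" if "i < n" for i
    using that Us Span_base_incl[OF K Us(1)] by (auto simp: b_def)
  have bc: "b i \<in> carrier R" if "i < n" for i
    using bE[OF that] EK by auto
  have comb: "combine (map k [0..<n]) Us = (\<Oplus>i\<in>{..<n}. k i \<otimes> b i)"
    if "k \<in> {..<n} \<rightarrow> K" for k
  proof -
    have "combine (map k [0..<n]) Us = (\<Oplus>i\<in>{..<n}. map k [0..<n] ! i \<otimes> Us ! i)"
      using Us(1,3) that Kc(3) by (subst combine_eq_finsum) auto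
    also have "\<dots> = (\<Oplus>i\<in>{..<n}. k i \<otimes> b i)"
      using that Kc(3) bc by (intro finsum_cong') (auto simp: b_def Pi_def)
    finally show ?thesis .
  qed
  have Espan: "(\<Oplus>i\<in>{..<n}. k i \<otimes> b i) \<in> E" if "k \<in> {..<n} \<rightarrow> K" for k
  proof -
    have "combine (map k [0..<n]) Us \<in> Span K Us"
      using that by (subst Span_mem_iff_length_version[OF K Us(1)], intro exI[of _ "map k [0..<n]"]) (auto simp: Us(3))
    then show ?thesis using comb[OF that] Us(4) by simp
  qed
  have uniq: "c i x = k i"
    if "i < n" "k \<in> {..<n} \<rightarrow> K" "x = (\<Oplus>i\<in>{..<n}. k i \<otimes> b i)" for i x k
  proof -
    have "x \<in> Span K Us"
      unfolding Us(4) that(3) by (rule Espan[OF that(2)])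
    then have ex1: "\<exists>!Ks. set Ks \<subseteq> K \<and> length Ks = length Us \<and> x = combine Ks Us"
      using unique_decomposition[OF K Us(2)] by blast
    have "(THE Ks. set Ks \<subseteq> K \<and> length Ks = length Us \<and> x = combine Ks Us) = map k [0..<n]"
      by (rule the1_equality[OF ex1]) (use that comb[OF that(2)] Us(3) in auto)
    then show ?thesis using that(1) by (simp add: c_def)
  qed
  have ex: "\<exists>k. k \<in> {..<n} \<rightarrow> K \<and> x = (\<Oplus>i\<in>{..<n}. k i \<otimes> b i)" if x: "x \<in> E" for x
  proof -
    obtain Ks where Ks': "set Ks \<subseteq> K" "length Ks = length Us" "x = combine Ks Us"
      using Span_mem_iff_length_version[OF K Us(1), THEN iffD1, OF x[folded Us(4)]] by blast
    have *: "(\<lambda>i. Ks ! i) \<in> {..<n} \<rightarrow> K"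
      using Ks'(1,2) Us(3) by auto
    have "map (\<lambda>i. Ks ! i) [0..<n] = Ks"
      using Ks' Us(3) by (auto intro!: nth_equalityI)
    then have "x = (\<Oplus>i\<in>{..<n}. Ks ! i \<otimes> b i)"
      using comb[OF *] Ks'(3) by argo
    with * show ?thesis by blast
  qed
  have cK: "c i x \<in> K" if "i < n" "x \<in> E" for i x
  proof -
    obtain k where k: "k \<in> {..<n} \<rightarrow> K" "x = (\<Oplus>i\<in>{..<n}. k i \<otimes> b i)"
      using ex[OF \<open>x \<in> E\<close>] by blast
    have "k i \<in> K" using k(1) that(1) by auto
    then show ?thesis using uniq[OF that(1) k] by simp
  qed
  have cx: "x = (\<Oplus>i\<in>{..<n}. c i x \<otimes> b i)" if x: "x \<in> E" for x
  proof -
    obtain k where k: "k \<in> {..<n} \<rightarrow> K" "x = (\<Oplus>i\<in>{..<n}. k i \<otimes> b i)"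
      using ex[OF x] by blast
    have "(\<Oplus>i\<in>{..<n}. k i \<otimes> b i) = (\<Oplus>i\<in>{..<n}. c i x \<otimes> b i)"
      using uniq[OF _ k] cK[OF _ x] bc Kc(3) by (intro finsum_cong') (auto simp: Pi_def subset_iff)
    with k(2) show ?thesis by (rule trans)
  qed
  have c_add: "c i (x \<oplus> y) = c i x \<oplus> c i y" if "i < n" "x \<in> E" "y \<in> E" for i x y
  proof (rule uniq[OF that(1)])
    show "(\<lambda>i. c i x \<oplus> c i y) \<in> {..<n} \<rightarrow> K"
      using that cK Ks by auto
    have "x \<oplus> y = (\<Oplus>i\<in>{..<n}. c i x \<otimes> b i) \<oplus> (\<Oplus>i\<in>{..<n}. c i y \<otimes> b i)"
      by (rule arg_cong2[where f = "(\<oplus>)", OF cx[OF that(2)] cx[OF that(3)]])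
    also have "\<dots> = (\<Oplus>i\<in>{..<n}. c i x \<otimes> b i \<oplus> c i y \<otimes> b i)"
      using cK that bc Kc(3) by (intro finsum_addf[symmetric]) (auto simp: Pi_def subset_iff)
    also have "\<dots> = (\<Oplus>i\<in>{..<n}. (c i x \<oplus> c i y) \<otimes> b i)"
      using cK that bc Kc(3) by (intro finsum_cong') (auto simp: Pi_def subset_iff l_distr)
    finally show "x \<oplus> y = (\<Oplus>i\<in>{..<n}. (c i x \<oplus> c i y) \<otimes> b i)" .
  qed
  have c_smult: "c i (k \<otimes> x) = k \<otimes> c i x" if "i < n" "k \<in> K" "x \<in> E" for i k x
  proof (rule uniq[OF that(1)])
    show "(\<lambda>i. k \<otimes> c i x) \<in> {..<n} \<rightarrow> K"
      using that cK Ks by auto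
    have "k \<otimes> x = k \<otimes> (\<Oplus>i\<in>{..<n}. c i x \<otimes> b i)"
      by (rule arg_cong[OF cx[OF that(3)]])
    also have "\<dots> = (\<Oplus>i\<in>{..<n}. k \<otimes> (c i x \<otimes> b i))"
      using cK that bc Kc(3) by (intro finsum_rdistr) (auto simp: Pi_def subset_iff)
    also have "\<dots> = (\<Oplus>i\<in>{..<n}. (k \<otimes> c i x) \<otimes> b i)"
      using cK that bc Kc(3) by (intro finsum_cong') (auto simp: Pi_def subset_iff m_assoc)
    finally show "k \<otimes> x = (\<Oplus>i\<in>{..<n}. (k \<otimes> c i x) \<otimes> b i)" .
  qed
  have c_b: "c i (b j) = (if i = j then \<one> else \<zero>)" if "i < n" "j < n" for i j
  proof (rule uniq[OF that(1)])
    show "(\<lambda>i. if i = j then \<one> else \<zero>) \<in> {..<n} \<rightarrow> K"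
      using Kc by auto
    have "b j = (\<Oplus>i\<in>{..<n}. if j = i then b i else \<zero>)"
      using that bc by (intro finsum_singleton[symmetric]) auto
    also have "\<dots> = (\<Oplus>i\<in>{..<n}. (if i = j then \<one> else \<zero>) \<otimes> b i)"
      using bc by (intro finsum_cong') (auto simp: Pi_def)
    finally show "b j = (\<Oplus>i\<in>{..<n}. (if i = j then \<one> else \<zero>) \<otimes> b i)" .
  qed
  have "Span K (map b [0..<n]) = E"
    unfolding Us_b by (fact Us(4))
  with bE cK cx c_add c_smult c_b have "coordinate_system K n E b c"
    unfolding coordinate_system_def by blast
  then show thesis by (rule that)
qed

text \<open>The powers with exponents from 0 to \<open>n\<close> are \<open>n + 1\<close> vectors in
  a space of dimension \<open>n\<close>. The resulting relation shows that \<open>x\<close> is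
  algebraic over \<open>Q\<close>.\<close>

lemma power_dependent:
  assumes Q: "subfield Q R" "dimension n Q V" and V: "subring V R" and x: "x \<in> V"
  obtains k where "k \<in> {..n} \<rightarrow> Q" "\<exists>i\<le>n. k i \<noteq> \<zero>" "(\<Oplus>i\<in>{..n}. k i \<otimes> x [^] i) = \<zero>"
proof -
  note Vs = subringE[OF V]
  have pw: "x [^] (i::nat) \<in> V" for i
    by (induction i) (use x Vs in auto)
  define Us where "Us = map (\<lambda>i::nat. x [^] i) [0..<Suc n]"
  have Us: "set Us \<subseteq> V" "length Us = Suc n"
    using pw by (auto simp: Us_def)
  have nth: "Us ! i = x [^] i" if "i \<le> n" for i
    using that by (simp add: Us_def del: upt_Suc)
  have "\<not> independent Q Us"
    using independent_length_le_dimension[OF Q(1,2) _ Us(1)] Us(2) by force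
  then obtain Ks where Ks: "length Ks = length Us" "combine Ks Us = \<zero>" "set Ks \<subseteq> Q" "set Ks \<noteq> {\<zero>}"
    using dependent_imp_non_trivial_combine[OF Q(1), of Us] Us(1) Vs(1) by blast
  have KQ: "Ks ! i \<in> Q" if "i \<le> n" for i
    using that Ks(1,3) Us(2) by auto
  show thesis
  proof (rule that[of "\<lambda>i. Ks ! i"])
    show "(\<lambda>i. Ks ! i) \<in> {..n} \<rightarrow> Q"
      using KQ by auto
    show "\<exists>i\<le>n. Ks ! i \<noteq> \<zero>"
    proof (rule ccontr)
      assume "\<not> (\<exists>i\<le>n. Ks ! i \<noteq> \<zero>)"
      then have "set Ks \<subseteq> {\<zero>}"
        using Ks(1) Us(2) by (auto simp: in_set_conv_nth less_Suc_eq_le)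
      \<comment> \<open>The empty list also satisfies \<open>set Ks \<noteq> {\<zero>}\<close>, so
        it has to be excluded by its length.\<close>
      moreover have "Ks \<noteq> []"
        using Ks(1) Us(2) by auto
      ultimately show False
        using Ks(4) by (cases Ks) auto
    qed
    have "combine Ks Us = (\<Oplus>i\<in>{..<length Us}. Ks ! i \<otimes> Us ! i)"
      using Ks Us Vs subfield_zero_one(3)[OF Q(1)] by (intro combine_eq_finsum) auto
    also have "\<dots> = (\<Oplus>i\<in>{..n}. Ks ! i \<otimes> x [^] i)"
      using KQ pw Vs(1) subfield_zero_one(3)[OF Q(1)] nth Us(2)
      by (intro finsum_cong') (auto simp: Pi_def subset_iff less_Suc_eq_le)
    finally show "(\<Oplus>i\<in>{..n}. Ks ! i \<otimes> x [^] i) = \<zero>"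
      using Ks(2) by simp
  qed
qed

end

section \<open>Complex embeddings of number fields\<close>

context
  fixes R :: "('a, 'b) ring_scheme" (structure) and K :: "'a set"
  assumes ring: "ring R" and K: "subfield K R"
begin

interpretation ring R by (fact ring)

lemmas K_closed = subringE[OF subfieldE(1)[OF K]] and K_comm = subfieldE(4)[OF K]

text \<open>Complex polynomials act on functionals on \<open>K\<close>, the variable acting as the transpose of
  the multiplication by \<open>x\<close>.\<close>

definition poly_act :: "complex poly \<Rightarrow> 'a \<Rightarrow> ('a \<Rightarrow> complex) \<Rightarrow> 'a \<Rightarrow> complex" where
  "poly_act p x f y = (\<Sum>i\<le>Polynomial.degree p. Polynomial.coeff p i * f (x [^] i \<otimes> y))"

lemma poly_act_altdef:
  assumes "Polynomial.degree p \<le> N"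
  shows "poly_act p x f y = (\<Sum>i\<le>N. Polynomial.coeff p i * f (x [^] i \<otimes> y))"
  unfolding poly_act_def
  using assms by (intro sum.mono_neutral_left) (auto simp: Polynomial.coeff_eq_0)

lemma pow_closed_K: "x \<in> K \<Longrightarrow> x [^] (i::nat) \<in> K"
  by (induction i) (use K_closed in auto)

text \<open>Multiplication by the variable shifts the coefficients by one, and the additional factor
  \<open>x\<close> moves into the argument of the functional.\<close>

lemma poly_act_linear_factor:
  assumes "x \<in> K" "y \<in> K"
  shows "poly_act ([:- c, 1:] * p) x f y = poly_act p x f (x \<otimes> y) - c * poly_act p x f y"
proof -
  let ?N = "Polynomial.degree p"
  have "Polynomial.degree ([:- c, 1:] * p) \<le> Suc ?N"
    using Polynomial.degree_mult_le[of "[:- c, 1:]" p] by simp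
  then have "poly_act ([:- c, 1:] * p) x f y
      = (\<Sum>i\<le>Suc ?N. Polynomial.coeff ([:- c, 1:] * p) i * f (x [^] i \<otimes> y))"
    by (rule poly_act_altdef)
  also have "\<dots> = (\<Sum>i\<le>Suc ?N. Polynomial.coeff (pCons 0 p) i * f (x [^] i \<otimes> y))
      - c * (\<Sum>i\<le>Suc ?N. Polynomial.coeff p i * f (x [^] i \<otimes> y))"
    by (simp add: sum_distrib_left algebra_simps flip: sum_subtractf del: sum.atMost_Suc)
  also have "(\<Sum>i\<le>Suc ?N. Polynomial.coeff (pCons 0 p) i * f (x [^] i \<otimes> y))
      = (\<Sum>i\<le>?N. Polynomial.coeff p i * f (x [^] Suc i \<otimes> y))"
    by (simp add: sum.atMost_Suc_shift del: sum.atMost_Suc nat_pow_Suc)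
  also have "\<dots> = poly_act p x f (x \<otimes> y)"
    using assms pow_closed_K[OF assms(1)] K_closed(1) unfolding poly_act_def
    by (intro sum.cong) (auto simp: subset_iff m_assoc)
  also have "(\<Sum>i\<le>Suc ?N. Polynomial.coeff p i * f (x [^] i \<otimes> y)) = poly_act p x f y"
    by (rule poly_act_altdef[symmetric]) simp
  finally show ?thesis .
qed

lemma poly_act_additive:
  assumes "additive_functional R K f" "x \<in> K"
  shows "additive_functional R K (poly_act p x f)"
  using assms pow_closed_K[OF assms(2)] K_closed unfolding additive_functional_def poly_act_def
  by (auto simp: subset_iff r_distr distrib_left sum.distrib)

text \<open>Multiplications by \<open>s\<close> and by \<open>x\<close> commute on \<open>K\<close>,
  so a polynomial in the operator of \<open>x\<close> preserves the eigenspaces of the operator of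
  \<open>s\<close>. This is what makes simultaneous eigenfunctionals possible.\<close>

lemma poly_act_eigenvalue:
  assumes "\<And>y. y \<in> K \<Longrightarrow> f (s \<otimes> y) = c * f y" "s \<in> K" "x \<in> K" "y \<in> K"
  shows "poly_act p x f (s \<otimes> y) = c * poly_act p x f y"
proof -
  have "f (x [^] i \<otimes> (s \<otimes> y)) = c * f (x [^] i \<otimes> y)" for i :: nat
  proof -
    have "x [^] i \<otimes> (s \<otimes> y) = s \<otimes> (x [^] i \<otimes> y)"
    proof -
      have "x [^] i \<in> carrier R" "s \<in> carrier R" "y \<in> carrier R"
        using pow_closed_K[OF assms(3)] assms(2,4) K_closed(1) by auto
      then show ?thesis
        using K_comm[OF pow_closed_K[OF assms(3), of i] assms(2)] by (metis m_assoc)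
    qed
    then show ?thesis
      using assms(1)[of "x [^] i \<otimes> y"] pow_closed_K[OF assms(3), of i] assms(4) K_closed(6) by simp
  qed
  then show ?thesis
    by (simp add: poly_act_def sum_distrib_left mult_ac)
qed

text \<open>Among the non-zero polynomials that annihilate \<open>f\<close> take one of least degree
  and split off a root \<open>c\<close>. The cofactor has smaller degree, so it does not annihilate
  \<open>f\<close>, and it turns \<open>f\<close> into an eigenfunctional with eigenvalue
  \<open>c\<close>.\<close>

lemma ex_eigenfunctional:
  assumes x: "x \<in> K" and nz: "\<exists>y\<in>K. f y \<noteq> 0"
    and alg: "p \<noteq> 0" "\<And>y. y \<in> K \<Longrightarrow> poly_act p x f y = 0"
  obtains r c where "\<exists>y\<in>K. poly_act r x f y \<noteq> 0"
    and "\<And>y. y \<in> K \<Longrightarrow> poly_act r x f (x \<otimes> y) = c * poly_act r x f y"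
proof -
  define P where "P = (\<lambda>p. p \<noteq> 0 \<and> (\<forall>y\<in>K. poly_act p x f y = 0))"
  have "P p" using alg by (simp add: P_def)
  define q where "q = arg_min Polynomial.degree P"
  have q: "P q" and least: "P r \<Longrightarrow> Polynomial.degree q \<le> Polynomial.degree r" for r
    using arg_min_nat_lemma[of P p Polynomial.degree] \<open>P p\<close> by (auto simp: q_def)
  have "Polynomial.degree q \<noteq> 0"
  proof
    assume "Polynomial.degree q = 0"
    then obtain a where a: "q = [:a:]" using degree_eq_zeroE by blast
    then have "a \<noteq> 0" using q by (simp add: P_def)
    moreover have "poly_act q x f y = a * f y" if "y \<in> K" for y
      using that K_closed(1) by (auto simp: a poly_act_def subset_iff)
    ultimately show False using q nz by (auto simp: P_def)
  qed
  then obtain c where "poly q c = 0"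
    using fundamental_theorem_of_algebra by (metis constant_degree)
  then obtain r where r: "q = [:- c, 1:] * r"
    by (metis dvdE poly_eq_0_iff_dvd)
  have "r \<noteq> 0" using q r by (auto simp: P_def)
  then have "Polynomial.degree q = Suc (Polynomial.degree r)"
    unfolding r by (subst degree_mult_eq) auto
  then have "\<not> P r" using least by fastforce
  then show thesis
    using \<open>r \<noteq> 0\<close> q that[of r c] poly_act_linear_factor[OF x, of _ c r f] r
    by (auto simp: P_def)
qed

lemma rat_range_subfield:
  fixes q :: "rat \<Rightarrow> 'a"
  assumes q: "q \<in> Ring.ring_hom ring_of_type_algebra (R\<lparr>carrier := K\<rparr>)"
  shows "inj q" "subfield (range q) R"
proof -
  interpret F: field "ring_of_type_algebra :: rat ring"
    by (rule field_from_type_algebra)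
  have UNIV: "carrier (ring_of_type_algebra :: rat ring) = UNIV"
    by (simp add: ring_of_type_algebra_def)
  have "q \<in> Ring.ring_hom ring_of_type_algebra R"
    using q K_closed(1) by (auto simp: Ring.ring_hom_def)
  then have "ring_hom_ring (ring_of_type_algebra :: rat ring) R q"
    using ring F.ring_axioms by (intro ring_hom_ringI2)
  from ring_hom_ring.img_is_subfield[OF this F.carrier_is_subfield]
  show "inj q" "subfield (range q) R"
    using subfieldE(6)[OF K] by (simp_all add: UNIV)
qed

text \<open>A rational coordinate function is improved, one basis element after the other, to a
  common eigenfunctional \<open>f\<close> of all multiplications. Then
  \<open>f (x \<otimes> y) * f \<one> = f x * f y\<close>, and division by \<open>f \<one>\<close>
  gives a ring homomorphism.\<close>

lemma ex_complex_embedding: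
  fixes q :: "rat \<Rightarrow> 'a"
  assumes q: "q \<in> Ring.ring_hom ring_of_type_algebra (R\<lparr>carrier := K\<rparr>)"
    and dim: "dimension n (range q) K"
  obtains j where "j \<in> Ring.ring_hom (R\<lparr>carrier := K\<rparr>) (ring_of_type_algebra :: complex ring)"
proof -
  note Q = rat_range_subfield[OF q]
  have qK: "q r \<in> K" for r
    using ring_hom_closed[OF q] by (simp add: ring_of_type_algebra_def)
  then have qc: "q r \<in> carrier R" for r
    using K_closed(1) by auto
  have q_hom: "q (r + s) = q r \<oplus> q s" "q (r * s) = q r \<otimes> q s" "q 1 = \<one>" for r s
    using ring_hom_add[OF q, of r s] ring_hom_mult[OF q, of r s] ring_hom_one[OF q]
    by (simp_all add: ring_of_type_algebra_def)
  obtain b c where coord: "coordinate_system (range q) n K b c"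
    using dimension_coordinates[OF Q(2) dim] .
  note b = coordinate_systemD(1)[OF coord] and sp = coordinate_systemD(2)[OF coord]
    and cQ = coordinate_systemD(3)[OF coord] and c_add = coordinate_systemD(5)[OF coord]
    and c_sm = coordinate_systemD(6)[OF coord] and c_b = coordinate_systemD(7)[OF coord]
  have "n \<noteq> 0"
  proof
    assume "n = 0"
    then have "K = {\<zero>}"
      using dim dimension_zero[OF Q(2)] by blast
    then show False
      using K_closed(3) subfieldE(6)[OF K] by blast
  qed
  then have n: "0 < n" by simp
  \<comment> \<open>The coordinate along \<open>b 0\<close>, read as a rational number. It takes the
    value 1 at \<open>b 0\<close>, hence is not zero.\<close>
  define f0 :: "'a \<Rightarrow> complex" where "f0 x = of_rat (inv_into UNIV q (c 0 x))" for x
  define good where "good f \<longleftrightarrow> additive_functional R K f \<and> (\<exists>y\<in>K. f y \<noteq> 0) \<and>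
      (\<forall>r. \<forall>y\<in>K. f (q r \<otimes> y) = of_rat r * f y)" for f
  have inv_add: "inv_into UNIV q (u \<oplus> v) = inv_into UNIV q u + inv_into UNIV q v" if "u \<in> range q" "v \<in> range q" for u v
    using that Q(1) by (auto simp: q_hom(1)[symmetric])
  have inv_mult: "inv_into UNIV q (u \<otimes> v) = inv_into UNIV q u * inv_into UNIV q v" if "u \<in> range q" "v \<in> range q" for u v
    using that Q(1) by (auto simp: q_hom(2)[symmetric])
  have "f0 (b 0) = 1"
    using c_b[OF n n] Q(1) by (simp add: f0_def inv_f_f flip: q_hom(3))
  then have "good f0"
    using b[OF n] c_add[OF n] c_sm[OF n] cQ[OF n] inv_add inv_mult Q(1)
    by (auto simp: good_def additive_functional_def f0_def of_rat_add of_rat_mult intro!: bexI[of _ "b 0"])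
  \<comment> \<open>One more element \<open>x\<close> gets an eigenvalue, while every eigenvalue
    relation already valid for \<open>f\<close> survives for \<open>h\<close>.\<close>
  have step: "\<exists>h c. good h \<and> (\<forall>y\<in>K. h (x \<otimes> y) = c * h y) \<and>
      (\<forall>s\<in>K. \<forall>c. (\<forall>y\<in>K. f (s \<otimes> y) = c * f y) \<longrightarrow> (\<forall>y\<in>K. h (s \<otimes> y) = c * h y))"
    if x: "x \<in> K" and f: "good f" for x f
  proof -
    obtain k where k: "k \<in> {..n} \<rightarrow> range q" "\<exists>i\<le>n. k i \<noteq> \<zero>" "(\<Oplus>i\<in>{..n}. k i \<otimes> x [^] i) = \<zero>"
      using power_dependent[OF Q(2) dim subfieldE(1)[OF K] x] by blast
    define a where "a i = inv_into UNIV q (k i)" for i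
    have ka: "k i = q (a i)" if "i \<le> n" for i
      using k(1) that by (auto simp: a_def f_inv_into_f Pi_def)
    \<comment> \<open>The relation between the powers of \<open>x\<close>, read with rational
      coefficients. It annihilates \<open>f\<close> because \<open>f\<close> is linear over the
      rationals through \<open>q\<close>.\<close>
    define p :: "complex poly" where "p = (\<Sum>i\<le>n. Polynomial.monom (of_rat (a i)) i)"
    have cp: "Polynomial.coeff p i = (if i \<le> n then of_rat (a i) else 0)" for i
      by (simp add: p_def coeff_sum)
    have q0: "q 0 = \<zero>"
      using q_hom(1)[of 0 0] qc[of 0] by (metis add.r_cancel_one add_0)
    have "p \<noteq> 0"
    proof
      assume "p = 0"
      then have "a i = 0" if "i \<le> n" for i
        using cp[of i] that by simp
      then show False using k(2) ka q0 by auto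
    qed
    have act0: "poly_act p x f y = 0" if y: "y \<in> K" for y
    proof -
      have "poly_act p x f y = (\<Sum>i\<le>n. Polynomial.coeff p i * f (x [^] i \<otimes> y))"
        by (intro poly_act_altdef degree_le) (auto simp: cp)
      also have "\<dots> = (\<Sum>i\<le>n. f (k i \<otimes> x [^] i \<otimes> y))"
        using f y pow_closed_K[OF x] K_closed qc by (intro sum.cong) (auto simp: cp good_def ka m_assoc subset_iff)
      also have "\<dots> = f (\<Oplus>i\<in>{..n}. k i \<otimes> x [^] i \<otimes> y)"
      proof (rule additive_functional_finsum[THEN conjunct2, symmetric])
        show "additive_functional R K f" using f by (simp add: good_def)
        show "subgroup K (add_monoid R)" using subring.axioms(1)[OF subfieldE(1)[OF K]] .
        show "(\<lambda>i. k i \<otimes> x [^] i \<otimes> y) \<in> {..n} \<rightarrow> K"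
          using y pow_closed_K[OF x] K_closed(6) qK ka by auto
      qed simp
      also have "(\<Oplus>i\<in>{..n}. k i \<otimes> x [^] i \<otimes> y) = (\<Oplus>i\<in>{..n}. k i \<otimes> x [^] i) \<otimes> y"
        using y pow_closed_K[OF x] K_closed qc ka by (intro finsum_ldistr[symmetric]) (auto simp: subset_iff)
      also have "\<dots> = \<zero>"
        using k(3) y K_closed(1) by auto
      also have "f \<zero> = 0"
        using f K_closed(2) by (auto simp: good_def additive_functional_zero)
      finally show ?thesis .
    qed
    have f_nz: "\<exists>y\<in>K. f y \<noteq> 0"
      using f by (simp add: good_def)
    obtain r c where r: "\<exists>y\<in>K. poly_act r x f y \<noteq> 0"
      "\<And>y. y \<in> K \<Longrightarrow> poly_act r x f (x \<otimes> y) = c * poly_act r x f y"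
      using ex_eigenfunctional[OF x f_nz \<open>p \<noteq> 0\<close> act0] by blast
    have eig: "\<forall>y\<in>K. poly_act r x f (s \<otimes> y) = c * poly_act r x f y"
      if "s \<in> K" "\<forall>y\<in>K. f (s \<otimes> y) = c * f y" for s c
      using poly_act_eigenvalue[of f s c x] that x by blast
    have "good (poly_act r x f)"
      using f r(1) eig[OF qK] poly_act_additive[OF _ x] by (auto simp: good_def)
    then show ?thesis
      using r(2) eig by blast
  qed
  have "\<exists>f. good f \<and> (\<forall>s\<in>S. \<exists>c. \<forall>y\<in>K. f (s \<otimes> y) = c * f y)" if "finite S" "S \<subseteq> K" for S
    using that
  proof (induction S)
    case empty
    then show ?case using \<open>good f0\<close> by blast
  next
    case (insert x S)
    then obtain f where f: "good f" "\<forall>s\<in>S. \<exists>c. \<forall>y\<in>K. f (s \<otimes> y) = c * f y"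
      by blast
    obtain h c where h: "good h" "\<forall>y\<in>K. h (x \<otimes> y) = c * h y"
      "\<forall>s\<in>K. \<forall>c. (\<forall>y\<in>K. f (s \<otimes> y) = c * f y) \<longrightarrow> (\<forall>y\<in>K. h (s \<otimes> y) = c * h y)"
      using step[of x f] f(1) insert.prems by blast
    have "\<exists>c. \<forall>y\<in>K. h (s \<otimes> y) = c * h y" if "s \<in> S" for s
      using f(2) h(3) that insert.prems by (meson insert_subset subsetD)
    then show ?case
      using h(1,2) by blast
  qed
  then obtain f where f: "good f" "\<forall>s\<in>b ` {..<n}. \<exists>c. \<forall>y\<in>K. f (s \<otimes> y) = c * f y"
    using b by (metis finite_imageI finite_lessThan image_subsetI lessThan_iff)
  \<comment> \<open>The elements that act on \<open>f\<close> by a scalar form a rational subspace.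
    It contains the basis, so it is all of \<open>K\<close>.\<close>
  define A where "A = {x \<in> K. \<exists>c. \<forall>y\<in>K. f (x \<otimes> y) = c * f y}"
  have f_add: "f (x \<oplus> y) = f x + f y" if "x \<in> K" "y \<in> K" for x y
    using f(1) that by (simp add: good_def additive_functional_def)
  have f_q: "f (q r \<otimes> y) = of_rat r * f y" if "y \<in> K" for r y
    using f(1) that by (simp add: good_def)
  have "Span (range q) (map b [0..<n]) \<subseteq> A"
  proof (rule Span_induct[OF Q(2)])
    show "set (map b [0..<n]) \<subseteq> A"
      using f(2) b by (auto simp: A_def)
    have "f (\<zero> \<otimes> y) = 0 * f y" if "y \<in> K" for y
      using that f(1) K_closed(1,2) by (auto simp: good_def additive_functional_zero)
    then show "\<zero> \<in> A"
      using K_closed(2) by (auto simp: A_def)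
  next
    fix x z assume "x \<in> A" "z \<in> A"
    then obtain c d where c: "x \<in> K" "z \<in> K" "\<forall>y\<in>K. f (x \<otimes> y) = c * f y" "\<forall>y\<in>K. f (z \<otimes> y) = d * f y"
      by (auto simp: A_def)
    have "f ((x \<oplus> z) \<otimes> y) = (c + d) * f y" if "y \<in> K" for y
    proof -
      have "(x \<oplus> z) \<otimes> y = x \<otimes> y \<oplus> z \<otimes> y"
        using that c K_closed(1) by (intro l_distr) auto
      then show ?thesis
        using that c K_closed(6) f_add by (simp add: distrib_right)
    qed
    then show "x \<oplus> z \<in> A"
      using c K_closed(7) by (auto simp: A_def)
  next
    fix k x assume "k \<in> range q" "x \<in> A"
    then obtain r c where c: "k = q r" "x \<in> K" "\<forall>y\<in>K. f (x \<otimes> y) = c * f y"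
      by (auto simp: A_def)
    have "f ((q r \<otimes> x) \<otimes> y) = (of_rat r * c) * f y" if "y \<in> K" for y
    proof -
      have "(q r \<otimes> x) \<otimes> y = q r \<otimes> (x \<otimes> y)"
        using that c K_closed(1) qc by (intro m_assoc) auto
      then show ?thesis
        using that c K_closed(6) f_q by simp
    qed
    then show "k \<otimes> x \<in> A"
      using c K_closed(6) qK by (auto simp: A_def)
  qed
  then have eig: "\<exists>c. \<forall>y\<in>K. f (x \<otimes> y) = c * f y" if "x \<in> K" for x
    using sp that by (auto simp: A_def)
  \<comment> \<open>Evaluation at \<open>\<one>\<close> identifies the eigenvalue of
    \<open>x\<close> as \<open>f x / f \<one>\<close>.\<close>
  have f_mult: "f (x \<otimes> y) * f \<one> = f x * f y" if xy: "x \<in> K" "y \<in> K" for x y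
  proof -
    obtain c where c: "\<forall>y\<in>K. f (x \<otimes> y) = c * f y"
      using eig[OF xy(1)] by blast
    then have "f (x \<otimes> \<one>) = c * f \<one>"
      using K_closed(3) by blast
    then show ?thesis
      using c xy K_closed(1) by (auto simp: subset_iff)
  qed
  have f1: "f \<one> \<noteq> 0"
  proof
    assume "f \<one> = 0"
    moreover obtain y where "y \<in> K" "f y \<noteq> 0"
      using f(1) by (auto simp: good_def)
    ultimately show False
      using f_mult[of y y] by simp
  qed
  show thesis
  proof (rule that[of "\<lambda>x. f x / f \<one>"], rule ring_hom_memI)
    fix x y assume *: "x \<in> carrier (R\<lparr>carrier := K\<rparr>)" "y \<in> carrier (R\<lparr>carrier := K\<rparr>)"
    then have xy: "x \<in> K" "y \<in> K" by simp_all
    have mult: "f (x \<otimes> y) = f x * f y / f \<one>"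
      using f1 f_mult[OF xy] by (simp add: eq_divide_eq)
    show "f (x \<otimes>\<^bsub>R\<lparr>carrier := K\<rparr>\<^esub> y) / f \<one>
        = (f x / f \<one>) \<otimes>\<^bsub>ring_of_type_algebra\<^esub> (f y / f \<one>)"
      and "f (x \<oplus>\<^bsub>R\<lparr>carrier := K\<rparr>\<^esub> y) / f \<one>
        = (f x / f \<one>) \<oplus>\<^bsub>ring_of_type_algebra\<^esub> (f y / f \<one>)"
      using mult f_add[OF xy] by (simp_all add: ring_of_type_algebra_def add_divide_distrib)
  qed (use f1 in \<open>simp_all add: ring_of_type_algebra_def\<close>)
qed

end

section \<open>Self-centralizing subfields and density\<close>

locale skew_field = ring +
  assumes Units_eq: "Units R = carrier R - {\<zero>}"
begin

lemma inv_nonzero: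
  assumes "x \<in> carrier R" "x \<noteq> \<zero>"
  shows "inv x \<in> carrier R" "inv x \<otimes> x = \<one>" "x \<otimes> inv x = \<one>"
proof -
  have "x \<in> Units R"
    using assms by (simp add: Units_eq)
  then show "inv x \<in> carrier R" "inv x \<otimes> x = \<one>" "x \<otimes> inv x = \<one>"
    by (simp_all add: Units_inv_closed)
qed

lemma one_not_zero: "\<one> \<noteq> \<zero>"
  using Units_eq Units_one_closed by blast

lemma no_zero_divisors:
  assumes "x \<in> carrier R" "y \<in> carrier R" "x \<otimes> y = \<zero>"
  shows "x = \<zero> \<or> y = \<zero>"
proof (rule disjCI)
  assume "y \<noteq> \<zero>"
  with assms(2) have inv: "inv y \<in> carrier R" "y \<otimes> inv y = \<one>"
    by (auto dest: inv_nonzero)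
  then have "x \<otimes> y \<otimes> inv y = x"
    using assms(1,2) m_assoc[of x y "inv y"] by simp
  then show "x = \<zero>"
    using assms(3) inv(1) by simp
qed

text \<open>The fixed points of this operator are the maximal commutative subsets, and
  \<open>centralizer (carrier R)\<close> is the center.\<close>

definition centralizer :: "'a set \<Rightarrow> 'a set" where
  "centralizer S = {x \<in> carrier R. \<forall>s\<in>S. s \<otimes> x = x \<otimes> s}"

text \<open>Zorn's lemma for commutative subsets containing \<open>g\<close>. Working with bare sets
  keeps unions of chains easy, and a maximal \<open>K\<close> is self-centralizing because adjoining
  an element of its centralizer leaves it commutative.\<close>

lemma ex_self_centralizing:
  assumes "g \<in> carrier R"
  obtains K where "g \<in> K" "centralizer K = K"
proof -
  define A where "A = {S. g \<in> S \<and> S \<subseteq> carrier R \<and> (\<forall>x\<in>S. \<forall>y\<in>S. x \<otimes> y = y \<otimes> x)}"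
  have "{g} \<in> A"
    using assms by (auto simp: A_def)
  have "\<Union>C \<in> A" if "C \<noteq> {}" "subset.chain A C" for C
  proof -
    have CA: "T \<in> A" if "T \<in> C" for T
      using that \<open>subset.chain A C\<close> by (auto simp: subset_chain_def)
    have "x \<otimes> y = y \<otimes> x" if xy: "x \<in> T" "y \<in> U" "T \<in> C" "U \<in> C" for x y T U
    proof -
      have "T \<subseteq> U \<or> U \<subseteq> T"
        using xy \<open>subset.chain A C\<close> by (auto simp: subset_chain_def)
      then show ?thesis
        using CA[of T] CA[of U] xy by (auto simp: A_def)
    qed
    moreover have "g \<in> \<Union>C" "\<Union>C \<subseteq> carrier R"
      using CA \<open>C \<noteq> {}\<close> by (auto simp: A_def)
    ultimately show ?thesis
      unfolding A_def by blast
  qed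
  then obtain K where K: "K \<in> A" and max: "\<And>T. T \<in> A \<Longrightarrow> K \<subseteq> T \<Longrightarrow> T = K"
    using subset_Zorn_nonempty[of A] \<open>{g} \<in> A\<close> by blast
  have "x \<in> K" if "x \<in> centralizer K" for x
  proof -
    have "insert x K \<in> A"
      using that K by (auto simp: A_def centralizer_def)
    then show ?thesis
      using max by blast
  qed
  moreover have "K \<subseteq> centralizer K"
    using K by (auto simp: A_def centralizer_def)
  ultimately show thesis
    using that[of K] K by (auto simp: A_def)
qed

text \<open>Commuting with all of \<open>K\<close> is inherited by sums, negatives, products and
  inverses, so the centralizer is a skew subfield. Being contained in its own centralizer makes it
  commutative.\<close>

lemma self_centralizing_subfield:
  assumes K: "centralizer K = K"
  shows "subfield K R"
proof -
  have mem: "x \<in> K \<longleftrightarrow> x \<in> carrier R \<and> (\<forall>s\<in>K. s \<otimes> x = x \<otimes> s)" for x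
    using K by (auto simp: centralizer_def)
  have Kc: "K \<subseteq> carrier R" and comm: "\<And>x y. x \<in> K \<Longrightarrow> y \<in> K \<Longrightarrow> x \<otimes> y = y \<otimes> x"
    using mem by blast+
  have "subring K R"
  proof (rule subringI[OF Kc])
    show "\<one> \<in> K"
      using Kc by (subst mem) auto
    show "\<ominus> x \<in> K" if "x \<in> K" for x
    proof -
      have "s \<otimes> \<ominus> x = \<ominus> x \<otimes> s" if "s \<in> K" for s
        using comm[OF that \<open>x \<in> K\<close>] that \<open>x \<in> K\<close> Kc by (simp add: r_minus l_minus subset_iff)
      then show ?thesis
        using that Kc by (subst mem) auto
    qed
    show "x \<otimes> y \<in> K" if "x \<in> K" "y \<in> K" for x y
    proof -
      have "s \<otimes> (x \<otimes> y) = (x \<otimes> y) \<otimes> s" if "s \<in> K" for s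
      proof -
        have c: "s \<in> carrier R" "x \<in> carrier R" "y \<in> carrier R"
          using that \<open>x \<in> K\<close> \<open>y \<in> K\<close> Kc by auto
        have "s \<otimes> (x \<otimes> y) = (s \<otimes> x) \<otimes> y"
          using c by (simp add: m_assoc)
        also have "\<dots> = x \<otimes> (s \<otimes> y)"
          using c comm[OF that \<open>x \<in> K\<close>] by (simp add: m_assoc)
        also have "\<dots> = (x \<otimes> y) \<otimes> s"
          using c comm[OF that \<open>y \<in> K\<close>] by (simp add: m_assoc)
        finally show ?thesis .
      qed
      then show ?thesis
        using that Kc by (subst mem) auto
    qed
    show "x \<oplus> y \<in> K" if "x \<in> K" "y \<in> K" for x y
    proof -
      have "s \<otimes> (x \<oplus> y) = (x \<oplus> y) \<otimes> s" if "s \<in> K" for s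
        using comm[OF that \<open>x \<in> K\<close>] comm[OF that \<open>y \<in> K\<close>] that \<open>x \<in> K\<close> \<open>y \<in> K\<close> Kc
        by (simp add: r_distr l_distr subset_iff)
      then show ?thesis
        using that Kc by (subst mem) auto
    qed
  qed
  then have "subcring K R"
    using comm by (rule subcringI)
  moreover have "Units (R\<lparr>carrier := K\<rparr>) = K - {\<zero>}"
  proof (intro equalityI subsetI)
    fix x assume "x \<in> Units (R\<lparr>carrier := K\<rparr>)"
    then obtain y where "x \<in> K" "y \<in> K" "x \<otimes> y = \<one>"
      by (auto simp: Units_def)
    then show "x \<in> K - {\<zero>}"
      using one_not_zero Kc by (auto simp: subset_iff)
  next
    fix x assume "x \<in> K - {\<zero>}"
    then have x: "x \<in> K" "x \<noteq> \<zero>" "x \<in> carrier R" using Kc by auto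
    note inv = inv_nonzero[OF x(3,2)]
    have "s \<otimes> inv x = inv x \<otimes> s" if s: "s \<in> K" for s
    proof -
      have "s \<in> carrier R" using s Kc by auto
      have "s \<otimes> inv x = inv x \<otimes> x \<otimes> (s \<otimes> inv x)"
        using inv \<open>s \<in> carrier R\<close> by simp
      also have "\<dots> = inv x \<otimes> (x \<otimes> s) \<otimes> inv x"
        using inv(1) \<open>s \<in> carrier R\<close> x(3) by (simp add: m_assoc)
      also have "\<dots> = inv x \<otimes> (s \<otimes> x) \<otimes> inv x"
        using comm[OF s x(1)] by simp
      also have "\<dots> = inv x \<otimes> s"
        using inv \<open>s \<in> carrier R\<close> x(3) by (simp add: m_assoc)
      finally show ?thesis .
    qed
    then have "inv x \<in> K"
      using inv(1) by (subst mem) auto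
    then show "x \<in> Units (R\<lparr>carrier := K\<rparr>)"
      using x(1) inv by (auto simp: Units_def)
  qed
  ultimately show ?thesis
    by (rule subfieldI)
qed

text \<open>For a subring \<open>K\<close> these are, on \<open>carrier R\<close>, the finite sums
  of maps \<open>x \<mapsto> k \<otimes> x \<otimes> d\<close> with \<open>k\<close> in
  \<open>K\<close> and \<open>d\<close> in \<open>R\<close>. The rule \<open>ext\<close> makes
  membership depend on the values on the carrier only.\<close>

inductive_set bimodule_maps :: "'a set \<Rightarrow> ('a \<Rightarrow> 'a) set" for K where
  zero: "(\<lambda>x. \<zero>) \<in> bimodule_maps K"
| ident: "(\<lambda>x. x) \<in> bimodule_maps K"
| add: "r \<in> bimodule_maps K \<Longrightarrow> s \<in> bimodule_maps K \<Longrightarrow> (\<lambda>x. r x \<oplus> s x) \<in> bimodule_maps K"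
| l_mult: "k \<in> K \<Longrightarrow> r \<in> bimodule_maps K \<Longrightarrow> (\<lambda>x. k \<otimes> r x) \<in> bimodule_maps K"
| r_mult: "d \<in> carrier R \<Longrightarrow> r \<in> bimodule_maps K \<Longrightarrow> (\<lambda>x. r x \<otimes> d) \<in> bimodule_maps K"
| ext: "r \<in> bimodule_maps K \<Longrightarrow> (\<And>x. x \<in> carrier R \<Longrightarrow> s x = r x) \<Longrightarrow> s \<in> bimodule_maps K"

lemma bimodule_maps_closed:
  assumes "r \<in> bimodule_maps K" "K \<subseteq> carrier R" "x \<in> carrier R"
  shows "r x \<in> carrier R"
  using assms(1,3) by induction (use assms(2) in auto)

lemma bimodule_maps_finsum:
  assumes "finite A" "K \<subseteq> carrier R" "\<And>i. i \<in> A \<Longrightarrow> r i \<in> bimodule_maps K"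
  shows "(\<lambda>x. \<Oplus>i\<in>A. r i x) \<in> bimodule_maps K"
  using assms(1,3)
proof (induction A)
  case empty
  then show ?case by (simp add: zero)
next
  case (insert a A)
  have "(\<lambda>x. r a x \<oplus> (\<Oplus>i\<in>A. r i x)) \<in> bimodule_maps K"
    using insert by (intro add) auto
  then show ?case
    by (rule ext) (use insert bimodule_maps_closed assms(2) in \<open>auto intro!: finsum_insert\<close>)
qed

text \<open>Jacobson density for the simple module \<open>R\<close> over the multiplications by elements of \<open>K\<close> from
  the left and of \<open>R\<close> from the right, whose endomorphisms are the left multiplications by elements
  of the centralizer of \<open>K\<close>.\<close>

lemma density:
  fixes b :: "nat \<Rightarrow> 'a"
  assumes K: "centralizer K = K"
    and "\<And>i. i < n \<Longrightarrow> b i \<in> carrier R"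
    and "\<And>m k. m < n \<Longrightarrow> k \<in> {..<m} \<rightarrow> K \<Longrightarrow> b m \<noteq> (\<Oplus>i\<in>{..<m}. k i \<otimes> b i)"
  shows "\<exists>r. \<forall>p<n. r p \<in> bimodule_maps K \<and> (\<forall>i<n. r p (b i) = (if i = p then \<one> else \<zero>))"
  using assms(2,3)
proof (induction n)
  case (Suc n)
  note Kf = self_centralizing_subfield[OF K]
  note Ks = subringE[OF subfieldE(1)[OF Kf]]
  have bc: "b i \<in> carrier R" if "i \<le> n" for i
    using Suc.prems(1) that by simp
  have "\<exists>r. \<forall>p<n. r p \<in> bimodule_maps K \<and> (\<forall>i<n. r p (b i) = (if i = p then \<one> else \<zero>))"
  proof (rule Suc.IH)
    show "b i \<in> carrier R" if "i < n" for i
      using bc[of i] that by simp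
    show "b m \<noteq> (\<Oplus>i\<in>{..<m}. k i \<otimes> b i)" if "m < n" "k \<in> {..<m} \<rightarrow> K" for m k
      using Suc.prems(2)[OF _ that(2)] that(1) by simp
  qed
  then obtain r where r: "\<And>p. p < n \<Longrightarrow> r p \<in> bimodule_maps K"
    and rb: "\<And>p i. p < n \<Longrightarrow> i < n \<Longrightarrow> r p (b i) = (if i = p then \<one> else \<zero>)"
    by blast
  have rc: "r p x \<in> carrier R" if "p < n" "x \<in> carrier R" for p x
    using bimodule_maps_closed[OF r Ks(1)] that by blast
  \<comment> \<open>If every map that kills the earlier \<open>b i\<close> also killed
    \<open>b n\<close>, then \<open>b n\<close> would be a left \<open>K\<close>-combination of
    them.\<close>
  have "\<exists>s\<in>bimodule_maps K. (\<forall>i<n. s (b i) = \<zero>) \<and> s (b n) \<noteq> \<zero>"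
  proof (rule ccontr)
    assume "\<not> ?thesis"
    then have kill: "s (b n) = \<zero>" if "s \<in> bimodule_maps K" "\<And>i. i < n \<Longrightarrow> s (b i) = \<zero>" for s
      using that by blast
    \<comment> \<open>The commutator of \<open>k\<close> with \<open>r p x\<close> vanishes at each
      earlier \<open>b i\<close>, where \<open>r p\<close> is \<open>\<zero>\<close> or
      \<open>\<one>\<close>. Hence it vanishes at \<open>b n\<close>, so \<open>r p (b n)\<close>
      commutes with \<open>K\<close> and lies in \<open>K\<close>.\<close>
    have fK: "r p (b n) \<in> K" if p: "p < n" for p
    proof -
      have "k \<otimes> r p (b n) = r p (b n) \<otimes> k" if k: "k \<in> K" for k
      proof -
        have kc: "k \<in> carrier R" using k Ks(1) by auto
        have "(\<lambda>x. k \<otimes> r p x \<oplus> r p x \<otimes> (\<ominus> k)) \<in> bimodule_maps K"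
          using r[OF p] k kc by (intro bimodule_maps.add bimodule_maps.l_mult bimodule_maps.r_mult) auto
        moreover have "k \<otimes> r p (b i) \<oplus> r p (b i) \<otimes> (\<ominus> k) = \<zero>" if "i < n" for i
          using rb[OF p that] kc by (auto simp: r_neg)
        ultimately have "k \<otimes> r p (b n) \<oplus> r p (b n) \<otimes> (\<ominus> k) = \<zero>"
          using kill[of "\<lambda>x. k \<otimes> r p x \<oplus> r p x \<otimes> (\<ominus> k)"] by blast
        then have "k \<otimes> r p (b n) \<ominus> r p (b n) \<otimes> k = \<zero>"
          using kc rc[OF p bc[of n]] by (simp add: r_minus minus_eq)
        then show ?thesis
          using kc rc[OF p bc[of n]] by simp
      qed
      then show ?thesis
        using rc[OF p bc[of n]] K by (auto simp: centralizer_def)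
    qed
    \<comment> \<open>The difference between \<open>x\<close> and its interpolation from the
      \<open>b i\<close> vanishes at each of them. Its vanishing at \<open>b n\<close> is the
      forbidden relation. The sign is written as a left factor \<open>\<ominus> \<one>\<close> from
      \<open>K\<close> to fit the rule \<open>l_mult\<close>.\<close>
    define s where "s = (\<lambda>x. x \<oplus> (\<ominus> \<one>) \<otimes> (\<Oplus>i\<in>{..<n}. r i x \<otimes> b i))"
    have sum_c: "(\<Oplus>i\<in>{..<n}. r i x \<otimes> b i) \<in> carrier R" if "x \<in> carrier R" for x
      using that rc bc by (intro finsum_closed) auto
    have "s \<in> bimodule_maps K"
      unfolding s_def using r bc Ks
      by (intro bimodule_maps.add bimodule_maps.ident bimodule_maps.l_mult bimodule_maps.r_mult bimodule_maps_finsum) auto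
    moreover have "s (b j) = \<zero>" if j: "j < n" for j
    proof -
      have "(\<Oplus>i\<in>{..<n}. r i (b j) \<otimes> b i) = (\<Oplus>i\<in>{..<n}. if j = i then b i else \<zero>)"
        using rb j bc by (intro finsum_cong') auto
      also have "\<dots> = b j"
        using j bc by (intro finsum_singleton) auto
      finally show ?thesis
        using bc[of j] j by (simp add: s_def l_minus r_neg)
    qed
    ultimately have "s (b n) = \<zero>"
      using kill by blast
    then have "b n \<ominus> (\<Oplus>i\<in>{..<n}. r i (b n) \<otimes> b i) = \<zero>"
      using sum_c[OF bc[of n]] by (simp add: s_def l_minus minus_eq)
    then have "b n = (\<Oplus>i\<in>{..<n}. r i (b n) \<otimes> b i)"
      using sum_c[OF bc[of n]] bc[of n] by simp
    then show False
      using Suc.prems(2)[of n "\<lambda>i. r i (b n)"] fK by auto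
  qed
  then obtain s where s: "s \<in> bimodule_maps K" "\<And>i. i < n \<Longrightarrow> s (b i) = \<zero>" "s (b n) \<noteq> \<zero>"
    by blast
  have snc: "s (b n) \<in> carrier R"
    using bimodule_maps_closed[OF s(1) Ks(1)] bc by blast
  note inv = inv_nonzero[OF snc s(3)]
  define t where "t = (\<lambda>x. s x \<otimes> inv (s (b n)))"
  have t: "t \<in> bimodule_maps K" "\<And>i. i < n \<Longrightarrow> t (b i) = \<zero>" "t (b n) = \<one>"
    using s inv by (auto simp: t_def bimodule_maps.r_mult)
  \<comment> \<open>Subtracting a right multiple of \<open>t\<close> removes the value of
    \<open>r p\<close> at \<open>b n\<close> and leaves the values at the earlier \<open>b i\<close>
    alone.\<close>
  define r' where "r' p = (if p = n then t else (\<lambda>x. r p x \<oplus> t x \<otimes> (\<ominus> r p (b n))))" for p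
  show ?case
  proof (intro exI[of _ r'] allI impI conjI)
    fix p assume p: "p < Suc n"
    show "r' p \<in> bimodule_maps K"
      using p t r rc[OF _ bc[of n]] by (auto simp: r'_def intro!: bimodule_maps.add bimodule_maps.r_mult)
    fix i assume i: "i < Suc n"
    show "r' p (b i) = (if i = p then \<one> else \<zero>)"
      using p i t rb rc[OF _ bc[of n]] by (auto simp: r'_def less_Suc_eq r_neg)
  qed
qed simp

end

section \<open>The complex span of the image of a matrix representation\<close>

text \<open>This is the condition on a single matrix in the last clause of
  \<open>complex_splitting\<close>, stated for entry functions so that it can be closed under sums
  and multiples without carrier conditions.\<close>

definition complex_combination ::
    "nat \<Rightarrow> ('a \<Rightarrow> complex mat) \<Rightarrow> 'a set \<Rightarrow> (nat \<Rightarrow> nat \<Rightarrow> complex) \<Rightarrow> bool" where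
  "complex_combination n \<phi> S f \<longleftrightarrow> (\<exists>(m::nat) x c. (\<forall>k<m. x k \<in> S) \<and>
     (\<forall>i<n. \<forall>j<n. f i j = (\<Sum>k<m. c k * \<phi> (x k) $$ (i, j))))"

lemma complex_combination_zero: "complex_combination n \<phi> S (\<lambda>i j. 0)"
  unfolding complex_combination_def by (rule exI[of _ 0]) simp

lemma complex_combination_single:
  assumes "x \<in> S" "\<And>i j. i < n \<Longrightarrow> j < n \<Longrightarrow> f i j = \<phi> x $$ (i, j)"
  shows "complex_combination n \<phi> S f"
  unfolding complex_combination_def
  by (rule exI[of _ 1], rule exI[of _ "\<lambda>_. x"], rule exI[of _ "\<lambda>_. 1"]) (use assms in auto)

lemma complex_combination_scale:
  assumes "complex_combination n \<phi> S f"
  shows "complex_combination n \<phi> S (\<lambda>i j. a * f i j)"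
proof -
  obtain m x c where *: "\<forall>k<m. x k \<in> S"
    "\<forall>i<n. \<forall>j<n. f i j = (\<Sum>k<(m::nat). c k * \<phi> (x k) $$ (i, j))"
    using assms unfolding complex_combination_def by blast
  show ?thesis
    unfolding complex_combination_def
    by (rule exI[of _ m], rule exI[of _ x], rule exI[of _ "\<lambda>k. a * c k"])
      (use * in \<open>simp add: sum_distrib_left mult_ac\<close>)
qed

lemma complex_combination_add:
  assumes "complex_combination n \<phi> S f" "complex_combination n \<phi> S g"
  shows "complex_combination n \<phi> S (\<lambda>i j. f i j + g i j)"
proof -
  obtain m x c where *: "\<forall>k<m. x k \<in> S"
    "\<forall>i<n. \<forall>j<n. f i j = (\<Sum>k<(m::nat). c k * \<phi> (x k) $$ (i, j))"
    using assms unfolding complex_combination_def by blast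
  obtain m' x' c' where **: "\<forall>k<m'. x' k \<in> S"
    "\<forall>i<n. \<forall>j<n. g i j = (\<Sum>k<(m'::nat). c' k * \<phi> (x' k) $$ (i, j))"
    using assms unfolding complex_combination_def by blast
  define y where "y k = (if k < m then x k else x' (k - m))" for k
  define d where "d k = (if k < m then c k else c' (k - m))" for k
  have "(\<Sum>k<m + m'. d k * \<phi> (y k) $$ (i, j))
      = (\<Sum>k<m. c k * \<phi> (x k) $$ (i, j)) + (\<Sum>k<m'. c' k * \<phi> (x' k) $$ (i, j))" for i j
  proof -
    have "(\<Sum>k<m + m'. d k * \<phi> (y k) $$ (i, j))
        = (\<Sum>k<m. d k * \<phi> (y k) $$ (i, j)) + (\<Sum>k = m..<m + m'. d k * \<phi> (y k) $$ (i, j))"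
      using sum.atLeastLessThan_concat[of 0 m "m + m'" "\<lambda>k. d k * \<phi> (y k) $$ (i, j)"]
      by (simp add: atLeast0LessThan)
    also have "(\<Sum>k = m..<m + m'. d k * \<phi> (y k) $$ (i, j)) = (\<Sum>k<m'. d (k + m) * \<phi> (y (k + m)) $$ (i, j))"
      using sum.shift_bounds_nat_ivl[of "\<lambda>k. d k * \<phi> (y k) $$ (i, j)" 0 m m']
      by (simp add: atLeast0LessThan add.commute)
    finally show ?thesis
      by (simp add: d_def y_def)
  qed
  moreover have "\<forall>k<m + m'. y k \<in> S"
    using * ** by (auto simp: y_def)
  ultimately show ?thesis
    unfolding complex_combination_def using * ** by (intro exI[of _ "m + m'"] exI[of _ y] exI[of _ d]) simp
qed

lemma complex_combination_sum:
  assumes "finite A" "\<And>a. a \<in> A \<Longrightarrow> complex_combination n \<phi> S (f a)"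
  shows "complex_combination n \<phi> S (\<lambda>i j. \<Sum>a\<in>A. f a i j)"
  using assms by (induction A) (auto intro: complex_combination_zero complex_combination_add)

section \<open>Complex splittings\<close>

lemma complex_combination_cong:
  assumes "complex_combination n \<phi> S f" "\<And>i j. i < n \<Longrightarrow> j < n \<Longrightarrow> g i j = f i j"
  shows "complex_combination n \<phi> S g"
  using assms unfolding complex_combination_def by auto

lemma ring_of_type_algebra_simps:
  "carrier (ring_of_type_algebra :: 'c::ring_1 ring) = UNIV"
  "x \<otimes>\<^bsub>(ring_of_type_algebra :: 'c ring)\<^esub> y = x * y"
  "x \<oplus>\<^bsub>(ring_of_type_algebra :: 'c ring)\<^esub> y = x + y"
  "\<one>\<^bsub>(ring_of_type_algebra :: 'c ring)\<^esub> = 1"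
  "\<zero>\<^bsub>(ring_of_type_algebra :: 'c ring)\<^esub> = 0"
  by (simp_all add: ring_of_type_algebra_def)

text \<open>Right multiplications are linear for the left \<open>K\<close>-structure, so they have
  matrices over \<open>K\<close>, and \<open>j\<close> carries these entrywise to complex matrices.
  Density supplies all matrix units in the complex span of the image.\<close>

lemma (in skew_field) ex_complex_splitting:
  assumes K: "centralizer K = K" and dim: "dimension n K (carrier R)"
    and j: "j \<in> Ring.ring_hom (R\<lparr>carrier := K\<rparr>) ring_of_type_algebra"
    and E: "E \<subseteq> K" "\<And>e x. e \<in> E \<Longrightarrow> x \<in> carrier R \<Longrightarrow> e \<otimes> x = x \<otimes> e"
  shows "\<exists>\<phi>. complex_splitting R E n j \<phi>"
proof -
  note Kf = self_centralizing_subfield[OF K]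
  note Ks = subringE[OF subfieldE(1)[OF Kf]]
  obtain b c where coord: "coordinate_system K n (carrier R) b c"
    using dimension_coordinates[OF Kf dim] .
  note b = coordinate_systemD(1)[OF coord] and cK = coordinate_systemD(3)[OF coord]
    and cx = coordinate_systemD(4)[OF coord] and c_add = coordinate_systemD(5)[OF coord]
    and c_smult = coordinate_systemD(6)[OF coord] and c_b = coordinate_systemD(7)[OF coord]
  have j_hom: "x \<in> K \<Longrightarrow> y \<in> K \<Longrightarrow> j (x \<oplus> y) = j x + j y"
    "x \<in> K \<Longrightarrow> y \<in> K \<Longrightarrow> j (x \<otimes> y) = j x * j y" "j \<one> = 1" for x y
    using ring_hom_add[OF j, of x y] ring_hom_mult[OF j, of x y] ring_hom_one[OF j]
    by (simp_all add: ring_of_type_algebra_simps)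
  have j0: "j \<zero> = 0"
    using j_hom(1)[of \<zero> \<zero>] Ks(2) by simp
  define h where "h s x = j (c s x)" for s x
  have h_add: "h s (x \<oplus> y) = h s x + h s y" if "s < n" "x \<in> carrier R" "y \<in> carrier R" for s x y
    using that c_add j_hom(1) cK by (simp add: h_def)
  have h_smult: "h s (k \<otimes> x) = j k * h s x" if "s < n" "k \<in> K" "x \<in> carrier R" for s k x
    using that c_smult j_hom(2) cK by (simp add: h_def)
  have h_b: "h s (b i) = (if s = i then 1 else 0)" if "s < n" "i < n" for s i
    using that c_b j_hom(3) j0 by (simp add: h_def)
  have h0: "h s \<zero> = 0" if "s < n" for s
    using h_add[OF that, of \<zero> \<zero>] by simp
  have h_mult: "h s (x \<otimes> d) = (\<Sum>t<n. h t x * h s (b t \<otimes> d))"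
    if s: "s < n" and x: "x \<in> carrier R" and d: "d \<in> carrier R" for s x d
  proof -
    have cc: "c t x \<in> carrier R" if "t < n" for t
      using cK[OF that x] Ks(1) by blast
    have "x \<otimes> d = (\<Oplus>t\<in>{..<n}. c t x \<otimes> b t) \<otimes> d"
      by (rule arg_cong[OF cx[OF x], of "\<lambda>y. y \<otimes> d"])
    also have "\<dots> = (\<Oplus>t\<in>{..<n}. c t x \<otimes> b t \<otimes> d)"
      using d cc b by (intro finsum_ldistr) auto
    also have "\<dots> = (\<Oplus>t\<in>{..<n}. c t x \<otimes> (b t \<otimes> d))"
      using d cc b by (intro finsum_cong') (auto simp: m_assoc)
    finally have "h s (x \<otimes> d) = h s (\<Oplus>t\<in>{..<n}. c t x \<otimes> (b t \<otimes> d))"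
      by simp
    also have "\<dots> = (\<Sum>t<n. h s (c t x \<otimes> (b t \<otimes> d)))"
    proof (rule additive_functional_finsum[THEN conjunct2])
      show "additive_functional R (carrier R) (h s)"
        using h_add[OF s] by (simp add: additive_functional_def)
      show "subgroup (carrier R) (add_monoid R)"
        by (rule add.group_incl_imp_subgroup) (auto simp: add.is_group)
      show "(\<lambda>t. c t x \<otimes> (b t \<otimes> d)) \<in> {..<n} \<rightarrow> carrier R"
        using cc b d by auto
    qed simp
    also have "\<dots> = (\<Sum>t<n. h t x * h s (b t \<otimes> d))"
      using h_smult[OF s cK[OF _ x]] b d by (intro sum.cong) (auto simp: h_def)
    finally show ?thesis .
  qed
  \<comment> \<open>Row \<open>i\<close> holds the coordinates of \<open>b i \<otimes> d\<close>.
    With rows in place of columns the order of right multiplications agrees with that of matrix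
    products, so \<open>\<phi>\<close> is a homomorphism and not an anti-homomorphism.\<close>
  define \<phi> where "\<phi> d = mat n n (\<lambda>(i, s). h s (b i \<otimes> d))" for d
  have \<phi>_entry: "\<phi> d $$ (i, s) = h s (b i \<otimes> d)" if "i < n" "s < n" for d i s
    using that by (simp add: \<phi>_def)
  \<comment> \<open>For a central \<open>e\<close> right multiplication is left multiplication,
    which scales every coordinate.\<close>
  have \<phi>_scalar: "\<phi> e = j e \<cdot>\<^sub>m 1\<^sub>m n" if e: "e \<in> K" "\<And>x. x \<in> carrier R \<Longrightarrow> e \<otimes> x = x \<otimes> e" for e
  proof (rule eq_matI)
    fix i s assume "i < dim_row (j e \<cdot>\<^sub>m 1\<^sub>m n)" "s < dim_col (j e \<cdot>\<^sub>m 1\<^sub>m n)"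
    then have bd: "i < n" "s < n" by simp_all
    have "\<phi> e $$ (i, s) = h s (e \<otimes> b i)"
      using bd b e(2) by (simp add: \<phi>_entry)
    also have "\<dots> = j e * (if s = i then 1 else 0)"
      using bd b h_smult[OF bd(2) e(1)] h_b by simp
    finally show "\<phi> e $$ (i, s) = (j e \<cdot>\<^sub>m 1\<^sub>m n) $$ (i, s)"
      using bd by simp
  qed (simp_all add: \<phi>_def)
  have \<phi>_hom: "\<phi> \<in> Ring.ring_hom R (ring_mat TYPE(complex) n ())"
  proof (rule ring_hom_memI)
    fix x y assume xy: "x \<in> carrier R" "y \<in> carrier R"
    show "\<phi> x \<in> carrier (ring_mat TYPE(complex) n ())"
      by (simp add: \<phi>_def ring_mat_simps)
    have "\<phi> (x \<otimes> y) = \<phi> x * \<phi> y"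
    proof (rule eq_matI)
      fix i s assume "i < dim_row (\<phi> x * \<phi> y)" "s < dim_col (\<phi> x * \<phi> y)"
      then have bd: "i < n" "s < n" by (simp_all add: \<phi>_def)
      have "\<phi> (x \<otimes> y) $$ (i, s) = h s (b i \<otimes> x \<otimes> y)"
        using bd xy b by (simp add: \<phi>_entry m_assoc)
      also have "\<dots> = (\<Sum>t<n. h t (b i \<otimes> x) * h s (b t \<otimes> y))"
        using bd xy b by (intro h_mult) auto
      also have "\<dots> = (\<phi> x * \<phi> y) $$ (i, s)"
        using bd by (simp add: \<phi>_def scalar_prod_def atLeast0LessThan)
      finally show "\<phi> (x \<otimes> y) $$ (i, s) = (\<phi> x * \<phi> y) $$ (i, s)" .
    qed (simp_all add: \<phi>_def)
    then show "\<phi> (x \<otimes> y) = \<phi> x \<otimes>\<^bsub>ring_mat TYPE(complex) n ()\<^esub> \<phi> y"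
      by (simp add: ring_mat_simps)
    have "\<phi> (x \<oplus> y) = \<phi> x + \<phi> y"
      by (rule eq_matI) (use xy b h_add in \<open>auto simp: \<phi>_def r_distr\<close>)
    then show "\<phi> (x \<oplus> y) = \<phi> x \<oplus>\<^bsub>ring_mat TYPE(complex) n ()\<^esub> \<phi> y"
      by (simp add: ring_mat_simps)
  next
    have "\<phi> \<one> = j \<one> \<cdot>\<^sub>m 1\<^sub>m n"
      by (rule \<phi>_scalar) (use Ks(3) in auto)
    also have "\<dots> = 1\<^sub>m n"
      by (rule eq_matI) (auto simp: j_hom(3))
    finally show "\<phi> \<one> = \<one>\<^bsub>ring_mat TYPE(complex) n ()\<^esub>"
      by (simp add: ring_mat_simps)
  qed
  let ?span = "complex_combination n \<phi> (carrier R)"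
  have rc: "r (b i) \<in> carrier R" if "r \<in> bimodule_maps K" "i < n" for r i
    using bimodule_maps_closed[OF that(1) Ks(1) b[OF that(2)]] .
  \<comment> \<open>A left factor \<open>k\<close> scales all entries by \<open>j k\<close>, and a
    right factor is absorbed into \<open>d\<close>, which therefore has to vary in the
    induction.\<close>
  have span: "?span (\<lambda>i s. h s (r (b i) \<otimes> d))" if "r \<in> bimodule_maps K" "d \<in> carrier R" for r d
    using that
  proof (induction arbitrary: d)
    case zero
    show ?case
      by (rule complex_combination_cong[OF complex_combination_zero]) (use zero h0 in auto)
  next
    case ident
    then show ?case
      by (rule complex_combination_single) (simp add: \<phi>_entry)
  next
    case (add r s)
    show ?case
      by (rule complex_combination_cong[OF complex_combination_add[OF add.IH(1)[OF add.prems] add.IH(2)[OF add.prems]]])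
        (use add rc h_add in \<open>simp add: l_distr\<close>)
  next
    case (l_mult k r)
    show ?case
    proof (rule complex_combination_cong[OF complex_combination_scale[OF l_mult.IH[OF l_mult.prems], of "j k"]])
      fix i s assume bd: "i < n" "s < n"
      have "k \<in> carrier R" "r (b i) \<in> carrier R"
        using l_mult.hyps bd rc Ks(1) by auto
      then show "h s (k \<otimes> r (b i) \<otimes> d) = j k * h s (r (b i) \<otimes> d)"
        using h_smult[OF bd(2) l_mult.hyps(1), of "r (b i) \<otimes> d"] l_mult.prems by (simp add: m_assoc)
    qed
  next
    case (r_mult d' r)
    show ?case
      by (rule complex_combination_cong[OF r_mult.IH[of "d' \<otimes> d"]])
        (use r_mult rc in \<open>auto simp: m_assoc\<close>)
  next
    case (ext r s)
    show ?case
      by (rule complex_combination_cong[OF ext.IH[OF ext.prems]]) (use ext b in auto)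
  qed
  have indep: "b m \<noteq> (\<Oplus>i\<in>{..<m}. k i \<otimes> b i)" if m: "m < n" and k: "k \<in> {..<m} \<rightarrow> K" for m k
  proof
    assume *: "b m = (\<Oplus>i\<in>{..<m}. k i \<otimes> b i)"
    have "h m (\<Oplus>i\<in>{..<m}. k i \<otimes> b i) = (\<Sum>i<m. h m (k i \<otimes> b i))"
    proof (rule additive_functional_finsum[THEN conjunct2])
      show "additive_functional R (carrier R) (h m)"
        using h_add[OF m] by (simp add: additive_functional_def)
      show "subgroup (carrier R) (add_monoid R)"
        by (rule add.group_incl_imp_subgroup) (auto simp: add.is_group)
      show "(\<lambda>i. k i \<otimes> b i) \<in> {..<m} \<rightarrow> carrier R"
        using k Ks(1) b m by auto
    qed simp
    also have "\<dots> = 0"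
    proof (intro sum.neutral ballI)
      fix i assume "i \<in> {..<m}"
      then have "i < n" "i < m" "k i \<in> K"
        using k m by auto
      then show "h m (k i \<otimes> b i) = 0"
        using h_smult[OF m \<open>k i \<in> K\<close> b] h_b[OF m] by simp
    qed
    finally show False
      using h_b[OF m m] * by simp
  qed
  obtain r where r: "\<And>p. p < n \<Longrightarrow> r p \<in> bimodule_maps K"
    and rb: "\<And>p i. p < n \<Longrightarrow> i < n \<Longrightarrow> r p (b i) = (if i = p then \<one> else \<zero>)"
    using density[of K n b, OF K b indep] by blast
  have "?span (\<lambda>i s. M $$ (i, s))" for M
  proof -
    \<comment> \<open>The map \<open>r p\<close> followed by right multiplication by
      \<open>b q\<close> gives the matrix unit at position \<open>(p, q)\<close>.\<close>
    have "?span (\<lambda>i s. \<Sum>p<n. \<Sum>q<n. M $$ (p, q) * h s (r p (b i) \<otimes> b q))"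
      using r b by (intro complex_combination_sum complex_combination_scale span) auto
    then show ?thesis
    proof (rule complex_combination_cong)
      fix i s assume bd: "i < n" "s < n"
      have "h s (r p (b i) \<otimes> b q) = (if p = i then if q = s then 1 else 0 else 0)" if "p < n" "q < n" for p q
        using that bd rb b h_b h0 by auto
      then have "(\<Sum>p<n. \<Sum>q<n. M $$ (p, q) * h s (r p (b i) \<otimes> b q))
          = (\<Sum>p<n. \<Sum>q<n. if p = i then if q = s then M $$ (p, q) else 0 else 0)"
        by (intro sum.cong) auto
      also have "\<dots> = (\<Sum>p<n. if p = i then (\<Sum>q<n. if q = s then M $$ (p, q) else 0) else 0)"
        by (intro sum.cong) auto
      also have "\<dots> = M $$ (i, s)"
        using bd by (simp add: sum.delta')
      finally show "M $$ (i, s) = (\<Sum>p<n. \<Sum>q<n. M $$ (p, q) * h s (r p (b i) \<otimes> b q))"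
        by simp
    qed
  qed
  moreover have "j \<in> Ring.ring_hom (R\<lparr>carrier := E\<rparr>) ring_of_type_algebra"
    using j E(1) by (auto simp: Ring.ring_hom_def subset_iff)
  moreover have "\<forall>e\<in>E. \<phi> e = j e \<cdot>\<^sub>m 1\<^sub>m n"
    using E \<phi>_scalar by blast
  ultimately show ?thesis
    using \<phi>_hom unfolding complex_splitting_def complex_combination_def by blast
qed

lemma complex_splittingD:
  assumes "complex_splitting R E n \<iota> \<phi>"
  shows "x \<in> E \<Longrightarrow> y \<in> E \<Longrightarrow> \<iota> (x \<oplus>\<^bsub>R\<^esub> y) = \<iota> x + \<iota> y"
    "x \<in> E \<Longrightarrow> y \<in> E \<Longrightarrow> \<iota> (x \<otimes>\<^bsub>R\<^esub> y) = \<iota> x * \<iota> y"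
    "\<iota> \<one>\<^bsub>R\<^esub> = 1"
    "x \<in> carrier R \<Longrightarrow> \<phi> x \<in> carrier_mat n n"
    "x \<in> carrier R \<Longrightarrow> y \<in> carrier R \<Longrightarrow> \<phi> (x \<oplus>\<^bsub>R\<^esub> y) = \<phi> x + \<phi> y"
    "x \<in> carrier R \<Longrightarrow> y \<in> carrier R \<Longrightarrow> \<phi> (x \<otimes>\<^bsub>R\<^esub> y) = \<phi> x * \<phi> y"
    "\<phi> \<one>\<^bsub>R\<^esub> = 1\<^sub>m n"
    "x \<in> E \<Longrightarrow> \<phi> x = \<iota> x \<cdot>\<^sub>m 1\<^sub>m n"
    "M \<in> carrier_mat n n \<Longrightarrow> complex_combination n \<phi> (carrier R) (\<lambda>i j. M $$ (i, j))"
proof -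
  have \<iota>: "\<iota> \<in> Ring.ring_hom (R\<lparr>carrier := E\<rparr>) ring_of_type_algebra"
    and \<phi>: "\<phi> \<in> Ring.ring_hom R (ring_mat TYPE(complex) n ())"
    using assms by (simp_all add: complex_splitting_def)
  show "x \<in> E \<Longrightarrow> y \<in> E \<Longrightarrow> \<iota> (x \<oplus>\<^bsub>R\<^esub> y) = \<iota> x + \<iota> y"
    "x \<in> E \<Longrightarrow> y \<in> E \<Longrightarrow> \<iota> (x \<otimes>\<^bsub>R\<^esub> y) = \<iota> x * \<iota> y" "\<iota> \<one>\<^bsub>R\<^esub> = 1"
    using ring_hom_add[OF \<iota>, of x y] ring_hom_mult[OF \<iota>, of x y] ring_hom_one[OF \<iota>]
    by (simp_all add: ring_of_type_algebra_simps)
  show "x \<in> carrier R \<Longrightarrow> \<phi> x \<in> carrier_mat n n"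
    "x \<in> carrier R \<Longrightarrow> y \<in> carrier R \<Longrightarrow> \<phi> (x \<oplus>\<^bsub>R\<^esub> y) = \<phi> x + \<phi> y"
    "x \<in> carrier R \<Longrightarrow> y \<in> carrier R \<Longrightarrow> \<phi> (x \<otimes>\<^bsub>R\<^esub> y) = \<phi> x * \<phi> y"
    "\<phi> \<one>\<^bsub>R\<^esub> = 1\<^sub>m n"
    using ring_hom_closed[OF \<phi>, of x] ring_hom_add[OF \<phi>, of x y] ring_hom_mult[OF \<phi>, of x y]
      ring_hom_one[OF \<phi>]
    by (simp_all add: ring_mat_simps)
  show "x \<in> E \<Longrightarrow> \<phi> x = \<iota> x \<cdot>\<^sub>m 1\<^sub>m n"
    "M \<in> carrier_mat n n \<Longrightarrow> complex_combination n \<phi> (carrier R) (\<lambda>i j. M $$ (i, j))"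
    using assms by (simp_all add: complex_splitting_def complex_combination_def)
qed

text \<open>An \<open>E\<close>-basis of \<open>R\<close> is mapped to \<open>n\<^sup>2\<close> matrices that span all matrices. A linear
  dependency between them would yield a non-zero linear functional \<open>v\<close> vanishing on all of them.\<close>

lemma (in ring) complex_splitting_independent:
  assumes E: "subfield E R" and dim: "dimension (n\<^sup>2) E (carrier R)"
    and split: "complex_splitting R E n \<iota> \<phi>"
    and Us: "independent E Us"
    and rel: "\<And>i j. i < n \<Longrightarrow> j < n \<Longrightarrow> (\<Sum>k<length Us. w k * \<phi> (Us ! k) $$ (i, j)) = 0"
    and k: "k < length Us"
  shows "w k = 0"
proof -
  note split = complex_splittingD[OF split]
  have Uc: "set Us \<subseteq> carrier R"
    using independent_in_carrier[OF Us] .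
  obtain Vs where Vs: "length (Vs @ Us) = n\<^sup>2" "independent E (Vs @ Us)" "Span E (Vs @ Us) = carrier R"
    using complete_base[OF E dim Us Uc] by blast
  define Ws where "Ws = Vs @ Us"
  have Wc: "set Ws \<subseteq> carrier R"
    using independent_in_carrier[OF Vs(2)] by (simp add: Ws_def)
  have lenW: "length Ws = n\<^sup>2" using Vs(1) by (simp add: Ws_def)
  have WcI: "Ws ! l \<in> carrier R" if "l < n\<^sup>2" for l
    using Wc lenW that nth_mem[of l Ws] by auto
  \<comment> \<open>Row \<open>l\<close> is the image of the \<open>l\<close>-th basis element,
    flattened to length \<open>n\<^sup>2\<close>. Column \<open>p\<close> stands for the position
    \<open>(p div n, p mod n)\<close>.\<close>
  define A where "A = mat (n\<^sup>2) (n\<^sup>2) (\<lambda>(l, p). \<phi> (Ws ! l) $$ (p div n, p mod n))"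
  have A: "A \<in> carrier_mat (n\<^sup>2) (n\<^sup>2)" by (simp add: A_def)
  have divmod: "p div n < n" "p mod n < n" if "p < n\<^sup>2" for p
    using that by (auto simp: power2_eq_square less_mult_imp_div_less) (metis mod_less_divisor mult_zero_left not_less_zero neq0_conv)
  \<comment> \<open>The dependency is padded by zeros on \<open>Vs\<close>. As \<open>Us\<close> is
    the tail of the completed basis, its indices are shifted by \<open>length Vs\<close>.\<close>
  define w' where "w' = vec (n\<^sup>2) (\<lambda>l. if l < length Vs then 0 else w (l - length Vs))"
  have w'_carrier: "w' \<in> carrier_vec (n\<^sup>2)" by (simp add: w'_def)
  have Aw: "transpose_mat A *\<^sub>v w' = 0\<^sub>v (n\<^sup>2)"
  proof (rule eq_vecI)
    fix p assume "p < dim_vec (0\<^sub>v (n\<^sup>2) :: complex vec)"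
    then have p: "p < n\<^sup>2" by simp
    have "(transpose_mat A *\<^sub>v w') $ p
      = (\<Sum>l<n\<^sup>2. \<phi> (Ws ! l) $$ (p div n, p mod n) * (if l < length Vs then 0 else w (l - length Vs)))"
      using p by (simp add: scalar_prod_def A_def w'_def atLeast0LessThan)
    also have "\<dots> = (\<Sum>l\<in>(\<lambda>k. k + length Vs) ` {..<length Us}. \<phi> (Ws ! l) $$ (p div n, p mod n) * (if l < length Vs then 0 else w (l - length Vs)))"
    proof (rule sum.mono_neutral_right)
      show "(\<lambda>k. k + length Vs) ` {..<length Us} \<subseteq> {..<n\<^sup>2}"
        using lenW by (auto simp: Ws_def)
      show "\<forall>l\<in>{..<n\<^sup>2} - (\<lambda>k. k + length Vs) ` {..<length Us}.
        \<phi> (Ws ! l) $$ (p div n, p mod n) * (if l < length Vs then 0 else w (l - length Vs)) = 0"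
      proof
        fix l assume l: "l \<in> {..<n\<^sup>2} - (\<lambda>k. k + length Vs) ` {..<length Us}"
        have "l < length Vs"
        proof (rule ccontr)
          assume "\<not> l < length Vs"
          then have "l = (l - length Vs) + length Vs" "l - length Vs < length Us"
            using l lenW by (auto simp: Ws_def)
          then show False using l by blast
        qed
        then show "\<phi> (Ws ! l) $$ (p div n, p mod n) * (if l < length Vs then 0 else w (l - length Vs)) = 0"
          by simp
      qed
    qed simp
    also have "\<dots> = (\<Sum>k<length Us. w k * \<phi> (Us ! k) $$ (p div n, p mod n))"
      by (subst sum.reindex) (auto simp: Ws_def nth_append mult.commute)
    also have "\<dots> = 0"
      using rel divmod[OF p] by simp
    finally show "(transpose_mat A *\<^sub>v w') $ p = 0\<^sub>v (n\<^sup>2) $ p"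
      using p by simp
  qed (simp add: A_def)
  have "det A \<noteq> 0"
  proof
    assume "det A = 0"
    then obtain v where v: "v \<in> carrier_vec (n\<^sup>2)" "v \<noteq> 0\<^sub>v (n\<^sup>2)" "A *\<^sub>v v = 0\<^sub>v (n\<^sup>2)"
      using det_0_iff_vec_prod_zero[OF A] by blast
    \<comment> \<open>The linear functional on matrices with coefficient vector \<open>v\<close>. It
      vanishes on the basis images, hence on the image of \<open>R\<close>, since scalars from
      \<open>E\<close> act through \<open>\<iota>\<close>.\<close>
    define L where "L f = (\<Sum>p<n\<^sup>2. f (p div n) (p mod n) * v $ p)" for f :: "nat \<Rightarrow> nat \<Rightarrow> complex"
    define Z where "Z = {x \<in> carrier R. L (\<lambda>i j. \<phi> x $$ (i, j)) = 0}"
    have "Span E Ws \<subseteq> Z"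
    proof (rule Span_induct[OF E])
      show "set Ws \<subseteq> Z"
      proof
        fix x assume "x \<in> set Ws"
        then obtain l where l: "l < n\<^sup>2" "x = Ws ! l"
          using lenW by (auto simp: in_set_conv_nth)
        have "(A *\<^sub>v v) $ l = L (\<lambda>i j. \<phi> x $$ (i, j))"
          using l v(1) by (simp add: A_def scalar_prod_def L_def atLeast0LessThan)
        then show "x \<in> Z"
          using v(3) l WcI by (simp add: Z_def)
      qed
    next
      fix x y assume "x \<in> Z" "y \<in> Z"
      then have xy: "x \<in> carrier R" "y \<in> carrier R" "L (\<lambda>i j. \<phi> x $$ (i, j)) = 0" "L (\<lambda>i j. \<phi> y $$ (i, j)) = 0"
        by (auto simp: Z_def)
      have "L (\<lambda>i j. \<phi> (x \<oplus> y) $$ (i, j)) = L (\<lambda>i j. \<phi> x $$ (i, j)) + L (\<lambda>i j. \<phi> y $$ (i, j))"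
        using split(4)[OF xy(1)] split(4)[OF xy(2)] divmod
        by (simp add: L_def split(5) xy distrib_right flip: sum.distrib)
      then show "x \<oplus> y \<in> Z"
        using xy by (simp add: Z_def)
    next
      fix e x assume e: "e \<in> E" and "x \<in> Z"
      then have x: "x \<in> carrier R" "L (\<lambda>i j. \<phi> x $$ (i, j)) = 0"
        by (auto simp: Z_def)
      have ec: "e \<in> carrier R" using e subfield_zero_one(3)[OF E] by auto
      have "\<phi> (e \<otimes> x) = \<iota> e \<cdot>\<^sub>m \<phi> x"
        using split(4)[OF x(1)]
        by (simp add: split(6)[OF ec x(1)] split(8)[OF e] mult_smult_assoc_mat[OF one_carrier_mat])
      then have "L (\<lambda>i j. \<phi> (e \<otimes> x) $$ (i, j)) = \<iota> e * L (\<lambda>i j. \<phi> x $$ (i, j))"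
        using split(4)[OF x(1)] divmod by (simp add: L_def sum_distrib_left mult.assoc)
      then show "e \<otimes> x \<in> Z"
        using x ec by (simp add: Z_def)
    next
      have z: "\<zero> \<in> E" by (rule subfield_zero_one(1)[OF E])
      have "\<iota> \<zero> = 0"
        using split(1)[OF z z] by simp
      then have "\<phi> \<zero> = 0 \<cdot>\<^sub>m 1\<^sub>m n"
        using split(8)[OF z] by simp
      then show "\<zero> \<in> Z"
        using divmod by (simp add: Z_def L_def)
    qed
    then have LR: "L (\<lambda>i j. \<phi> x $$ (i, j)) = 0" if "x \<in> carrier R" for x
      using Vs(3) that by (auto simp: Z_def Ws_def)
    have "v $ q = 0" if q: "q < n\<^sup>2" for q
    proof -
      \<comment> \<open>The value of \<open>L\<close> at this matrix unit is \<open>v $ q\<close>.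
        It is zero because \<open>M\<close> is a complex combination of matrices in the image of
        \<open>R\<close>.\<close>
      define M where "M = mat n n (\<lambda>(i, j). if i = q div n \<and> j = q mod n then 1 else (0 :: complex))"
      obtain m x c where M: "\<forall>k<m. x k \<in> carrier R"
        "\<forall>i<n. \<forall>j<n. M $$ (i, j) = (\<Sum>k<(m::nat). c k * \<phi> (x k) $$ (i, j))"
        using split(9)[of M] by (auto simp: complex_combination_def M_def)
      have "L (\<lambda>i j. M $$ (i, j)) = (\<Sum>p<n\<^sup>2. \<Sum>k<m. c k * (\<phi> (x k) $$ (p div n, p mod n) * v $ p))"
        using divmod M(2) by (simp add: L_def sum_distrib_right mult.assoc)
      also have "\<dots> = (\<Sum>k<m. c k * L (\<lambda>i j. \<phi> (x k) $$ (i, j)))"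
        by (subst sum.swap) (simp add: L_def sum_distrib_left)
      also have "\<dots> = 0"
        using LR M(1) by simp
      finally have "L (\<lambda>i j. M $$ (i, j)) = 0" .
      moreover have "M $$ (p div n, p mod n) = (if p = q then 1 else 0)" if "p < n\<^sup>2" for p
        using divmod[OF that] by (auto simp: M_def) (metis div_mult_mod_eq)
      ultimately have "(\<Sum>p<n\<^sup>2. (if p = q then 1 else 0) * v $ p) = 0"
        by (simp add: L_def)
      then show ?thesis
        using q by (simp add: if_distrib[of "\<lambda>a. a * _"] cong: if_cong)
    qed
    then have "v = 0\<^sub>v (n\<^sup>2)"
      using v(1) by (intro eq_vecI) auto
    then show False using v(2) by simp
  qed
  then have "det (transpose_mat A) \<noteq> 0"
    by (simp add: det_transpose[OF A])
  then have "w' = 0\<^sub>v (n\<^sup>2)"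
    using det_0_iff_vec_prod_zero[of "transpose_mat A" "n\<^sup>2"] A Aw w'_carrier by auto
  moreover have "w' $ (length Vs + k) = w k"
    using k Vs(1) by (simp add: w'_def)
  ultimately show ?thesis
    using k Vs(1) by simp
qed

section \<open>Determinant and Cayley-Hamilton identity in order three\<close>

lemma det_3:
  fixes A :: "'a :: comm_ring_1 mat"
  assumes A: "A \<in> carrier_mat 3 3"
  shows "det A = A $$ (0,0) * (A $$ (1,1) * A $$ (2,2) - A $$ (1,2) * A $$ (2,1))
    - A $$ (0,1) * (A $$ (1,0) * A $$ (2,2) - A $$ (1,2) * A $$ (2,0))
    + A $$ (0,2) * (A $$ (1,0) * A $$ (2,1) - A $$ (1,1) * A $$ (2,0))"
proof -
  have det2: "det B = B $$ (0,0) * B $$ (1,1) - B $$ (0,1) * B $$ (1,0)"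
    if B: "B \<in> carrier_mat 2 2" for B :: "'a mat"
    using laplace_expansion_row[OF B, of 0] B
    by (simp add: numeral_2_eq_2 lessThan_Suc cofactor_def det_single mat_delete_def)
  show ?thesis
    using laplace_expansion_row[OF A, of 0] A
    by (simp add: numeral_3_eq_3 lessThan_Suc cofactor_def det2 mat_delete_def numeral_2_eq_2 algebra_simps)
qed

section \<open>Algebras of degree three\<close>

text \<open>Serves for comparison with another cubic relation, where only the constant coefficient
  must be recognized. Hence \<open>t\<close> and \<open>s\<close> remain anonymous.\<close>

lemma cayley_hamilton_3:
  fixes A :: "'a :: comm_ring_1 mat"
  assumes A: "A \<in> carrier_mat 3 3"
  obtains t s where "\<And>i j. i < 3 \<Longrightarrow> j < 3 \<Longrightarrow>
    (A * A * A) $$ (i, j) = t * (A * A) $$ (i, j) + s * A $$ (i, j) + (if i = j then det A else 0)"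
proof -
  let ?a = "\<lambda>i j. A $$ (i, j)"
  have mult: "(B * C) $$ (i, j) = B $$ (i, 0) * C $$ (0, j) + B $$ (i, 1) * C $$ (1, j) + B $$ (i, 2) * C $$ (2, j)"
    if "B \<in> carrier_mat 3 3" "C \<in> carrier_mat 3 3" "i < 3" "j < 3" for B C :: "'a mat" and i j
    using that by (auto simp: scalar_prod_def numeral_3_eq_3 numeral_2_eq_2 algebra_simps)
  have AA: "A * A \<in> carrier_mat 3 3" using A by simp
  show thesis
  proof (rule that)
    fix i j :: nat assume "i < 3" "j < 3"
    \<comment> \<open>The first coefficient is the trace, the second the negative of the sum of the
      principal minors of order two.\<close>
    then show "(A * A * A) $$ (i, j) = (?a 0 0 + ?a 1 1 + ?a 2 2) * (A * A) $$ (i, j)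
      + (?a 0 1 * ?a 1 0 + ?a 0 2 * ?a 2 0 + ?a 1 2 * ?a 2 1
        - ?a 0 0 * ?a 1 1 - ?a 0 0 * ?a 2 2 - ?a 1 1 * ?a 2 2) * ?a i j
      + (if i = j then det A else 0)"
    proof -
      have "i = 0 \<or> i = 1 \<or> i = 2" "j = 0 \<or> j = 1 \<or> j = 2"
        using \<open>i < 3\<close> \<open>j < 3\<close> by auto
      then show ?thesis
        by (elim disjE; simp add: mult[OF AA A] mult[OF A A] det_3[OF A] algebra_simps del: One_nat_def)
    qed
  qed
qed

context ring
begin

lemma dimension_subset_eq:
  assumes "subfield K R" "dimension n K V" "dimension n K W" "V \<subseteq> W"
  shows "V = W"
  using exists_base[OF assms(1,2)] independent_length_eq_dimension[OF assms(1,3)]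
    Span_base_incl[OF assms(1)] assms(4) by blast

text \<open>Both degrees have to be shown finite first: \<open>K\<close> is a subspace of a
  finite-dimensional space over \<open>E\<close>, and a list spanning \<open>R\<close> over
  \<open>E\<close> also spans it over \<open>K\<close>. The product formula then follows from the
  uniqueness of dimension.\<close>

lemma subfield_tower:
  assumes E: "subfield E R" and K: "subfield K R" and EK: "E \<subseteq> K"
    and dim: "dimension n E (carrier R)"
  obtains a b where "dimension a E K" "dimension b K (carrier R)" "n = a * b"
proof -
  note Ks = subringE[OF subfieldE(1)[OF K]]
  have "subgroup K (add_monoid R)"
    using subring.axioms(1)[OF subfieldE(1)[OF K]] .
  then have "subalgebra E K R"
    using EK Ks(6) by (auto simp: subalgebra_def subalgebra_axioms_def)
  then obtain a where a: "dimension a E K"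
    using subalbegra_incl_imp_finite_dimension[OF E finite_dimensionI[OF dim]] Ks(1)
    by (auto simp: finite_dimension_def)
  obtain Us where Us: "set Us \<subseteq> carrier R" "Span E Us = carrier R"
    using exists_base[OF E dim] by blast
  have "Span E Us \<subseteq> Span K Us"
    using Span_base_incl[OF K Us(1)] Span_subgroup_props[OF K Us(1)] Span_smult_closed[OF K Us(1)] EK
    by (intro Span_induct[OF E]) auto
  then have "Span K Us = carrier R"
    using Us(2) Span_subgroup_props(1)[OF K Us(1)] by blast
  then obtain b where b: "dimension b K (carrier R)"
    using Span_finite_dimension[OF K Us(1)] by (auto simp: finite_dimension_def)
  show thesis
    using that[OF a b] dimension_is_inj[OF E dim telescopic_base[OF E K a b]] by simp
qed

end

context skew_field
begin

text \<open>The degree of \<open>K\<close> over \<open>E\<close> divides 9. Degree 1 would make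
  \<open>K\<close> central and its centralizer everything, and degree 9 would make \<open>R\<close>
  commutative. In both cases \<open>R\<close> equals \<open>E\<close>, against dimension 9.\<close>

lemma cubic_self_centralizing_subfield:
  assumes E: "subfield E R" "centralizer (carrier R) = E"
    and dim: "dimension 9 E (carrier R)" and K: "centralizer K = K"
  shows "dimension 3 E K" "dimension 3 K (carrier R)"
proof -
  note Kf = self_centralizing_subfield[OF K]
  have Kc: "K \<subseteq> carrier R" using subfield_zero_one(3)[OF Kf] .
  have EK: "E \<subseteq> K"
    using K E(2) Kc by (auto simp: centralizer_def)
  have not1: "\<not> dimension 9 E E"
    using dimension_is_inj[OF E(1) _ dimension_one[OF E(1)], of 9] by auto
  obtain a b where ab: "dimension a E K" "dimension b K (carrier R)" "9 = a * b"
    using subfield_tower[OF E(1) Kf EK dim] .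
  have "a \<noteq> 1"
  proof
    assume "a = 1"
    then have "E = K"
      using dimension_subset_eq[OF E(1) dimension_one[OF E(1)] _ EK] ab(1) by simp
    then have "carrier R \<subseteq> K"
      using E(2) by (subst K[symmetric]) (auto simp: centralizer_def)
    then show False
      using Kc \<open>E = K\<close> dim not1 by auto
  qed
  moreover have "a \<noteq> 9"
  proof
    assume "a = 9"
    then have "K = carrier R"
      using dimension_subset_eq[OF E(1) _ dim Kc] ab(1) by simp
    then show False
      using K E(2) dim not1 by auto
  qed
  moreover have "a = 1 \<or> a = 3 \<or> a = 9"
  proof -
    have "a dvd 9" using ab(3) by (metis dvd_triv_left)
    then have "a \<le> 9" by (rule dvd_imp_le) simp
    then have "a \<in> {0,1,2,3,4,5,6,7,8,9}" by auto
    then show ?thesis using \<open>a dvd 9\<close> by auto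
  qed
  ultimately have "a = 3" "b = 3" using ab(3) by auto
  then show "dimension 3 E K" "dimension 3 K (carrier R)"
    using ab by simp_all
qed

text \<open>Otherwise \<open>E + E g\<close> would be a subfield of degree two.\<close>

lemma square_not_in_span:
  assumes E: "subfield E R" "\<And>e x. e \<in> E \<Longrightarrow> x \<in> carrier R \<Longrightarrow> e \<otimes> x = x \<otimes> e"
    and dim: "dimension n E (carrier R)" and n: "odd n"
    and g: "g \<in> carrier R" "g \<notin> E"
  shows "independent E [g \<otimes> g, g, \<one>]"
proof -
  note Ecs = subringE[OF subfieldE(1)[OF E(1)]]
  have Ec: "e \<in> carrier R" if "e \<in> E" for e using that Ecs(1) by auto
  have span1: "Span E [\<one>] = E"
    using Ec by (force simp: line_extension_mem_iff)
  define S where "S = Span E [g, \<one>]"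
  have S_mem: "x \<in> S \<longleftrightarrow> (\<exists>a\<in>E. \<exists>e\<in>E. x = a \<otimes> g \<oplus> e)" for x
    using span1 by (simp add: S_def line_extension_mem_iff)
  have "independent E [\<one>]"
    using one_not_zero by (intro li_Cons) auto
  then have ind: "independent E [g, \<one>]"
    using g span1 one_not_zero by (intro li_Cons) auto
  have dimS: "dimension 2 E S"
    using dimensionI[OF E(1) ind] by (simp add: S_def numeral_2_eq_2)
  note S = space_subgroup_props[OF E(1) dimS]
  have ES: "E \<subseteq> S"
  proof
    fix e assume "e \<in> E"
    then have "e = \<zero> \<otimes> g \<oplus> e" using g Ec by simp
    then show "e \<in> S" using \<open>e \<in> E\<close> Ecs(2) S_mem by blast
  qed
  have gS: "g \<in> S"
  proof -
    have "g = \<one> \<otimes> g \<oplus> \<zero>" using g by simp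
    then show ?thesis using Ecs(2,3) S_mem by blast
  qed
  have "g \<otimes> g \<notin> S"
  proof
    assume gg: "g \<otimes> g \<in> S"
    have g_mult: "g \<otimes> x \<in> S" if x: "x \<in> S" for x
    proof -
      obtain a e where ae: "a \<in> E" "e \<in> E" "x = a \<otimes> g \<oplus> e"
        using x S_mem by blast
      have "g \<otimes> (a \<otimes> g) = a \<otimes> (g \<otimes> g)"
        using E(2)[OF ae(1) g(1)] g(1) Ec[OF ae(1)] by (metis m_assoc)
      moreover have "g \<otimes> e = e \<otimes> g"
        using E(2)[OF ae(2) g(1)] by simp
      ultimately have "g \<otimes> x = a \<otimes> (g \<otimes> g) \<oplus> e \<otimes> g"
        using g(1) Ec ae by (simp add: r_distr)
      then show ?thesis
        using S(3,5) gg gS ae by simp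
    qed
    have S_mult: "x \<otimes> y \<in> S" if xy: "x \<in> S" "y \<in> S" for x y
    proof -
      obtain a e where ae: "a \<in> E" "e \<in> E" "x = a \<otimes> g \<oplus> e"
        using xy(1) S_mem by blast
      have yc: "y \<in> carrier R" using xy(2) S(1) by auto
      have "x \<otimes> y = a \<otimes> (g \<otimes> y) \<oplus> e \<otimes> y"
        using g(1) Ec ae yc by (simp add: l_distr m_assoc)
      then show ?thesis
        using S(3,5) g_mult xy(2) ae by simp
    qed
    have g_comm: "g \<otimes> y = y \<otimes> g" if y: "y \<in> S" for y
    proof -
      obtain a e where ae: "a \<in> E" "e \<in> E" "y = a \<otimes> g \<oplus> e"
        using y S_mem by blast
      have "g \<otimes> (a \<otimes> g) = a \<otimes> g \<otimes> g"
        using E(2)[OF ae(1) g(1)] g(1) Ec[OF ae(1)] by (metis m_assoc)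
      then show ?thesis
        using g(1) Ec ae E(2)[OF ae(2) g(1)] by (simp add: r_distr l_distr)
    qed
    have S_comm: "x \<otimes> y = y \<otimes> x" if xy: "x \<in> S" "y \<in> S" for x y
    proof -
      obtain a e where ae: "a \<in> E" "e \<in> E" "x = a \<otimes> g \<oplus> e"
        using xy(1) S_mem by blast
      have yc: "y \<in> carrier R" using xy(2) S(1) by auto
      have "a \<otimes> g \<otimes> y = y \<otimes> (a \<otimes> g)"
        using g_comm[OF xy(2)] E(2)[OF ae(1) yc] g(1) yc Ec[OF ae(1)] by (metis m_assoc)
      then show ?thesis
        using g(1) Ec ae yc E(2)[OF ae(2) yc] by (simp add: r_distr l_distr)
    qed
    \<comment> \<open>As \<open>g\<close> is not in \<open>E\<close>, the elements
      \<open>g \<otimes> x\<close> and \<open>x\<close> are independent and span \<open>S\<close>.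
      Writing \<open>\<one>\<close> in this basis produces the inverse of \<open>x\<close>.\<close>
    have S_inv: "\<exists>y\<in>S. y \<otimes> x = \<one>" if x: "x \<in> S" "x \<noteq> \<zero>" for x
    proof -
      have xc: "x \<in> carrier R" using x S(1) by auto
      have "g \<otimes> x \<notin> Span E [x]"
      proof
        assume "g \<otimes> x \<in> Span E [x]"
        then obtain k where k: "k \<in> E" "g \<otimes> x = k \<otimes> x"
          using xc Ec by (auto simp: line_extension_mem_iff)
        then have "(g \<ominus> k) \<otimes> x = \<zero>"
          using g(1) xc Ec by (simp add: minus_eq l_distr l_minus r_neg)
        then have "g \<ominus> k = \<zero>"
          using no_zero_divisors[of "g \<ominus> k" x] g(1) xc Ec k(1) x(2) by auto
        then show False
          using g Ec k(1) by simp
      qed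
      moreover have "independent E [x]"
        using x(2) xc by (intro li_Cons) auto
      ultimately have ix: "independent E [g \<otimes> x, x]"
        using g(1) xc by (intro li_Cons[OF m_closed])
      have "Span E [g \<otimes> x, x] = S"
        using independent_length_eq_dimension[OF E(1) dimS ix] g_mult[OF x(1)] x(1) by simp
      then have "\<one> \<in> Span E [g \<otimes> x, x]"
        using ES Ecs(3) by blast
      then obtain k l where kl: "k \<in> E" "l \<in> E" "\<one> = k \<otimes> (g \<otimes> x) \<oplus> (l \<otimes> x \<oplus> \<zero>)"
        by (auto simp: line_extension_mem_iff)
      then have "(k \<otimes> g \<oplus> l) \<otimes> x = \<one>"
        using g(1) xc Ec by (simp add: l_distr m_assoc)
      then show ?thesis
        using S_mem kl(1,2) by blast
    qed
    have "subring S R"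
      using S S_mult ES Ecs(3) by (intro subringI) auto
    then have "subcring S R"
      using S_comm by (rule subcringI)
    moreover have "Units (R\<lparr>carrier := S\<rparr>) = S - {\<zero>}"
    proof (intro equalityI subsetI)
      fix x assume "x \<in> Units (R\<lparr>carrier := S\<rparr>)"
      then obtain y where "x \<in> S" "y \<in> S" "x \<otimes> y = \<one>"
        by (auto simp: Units_def)
      then show "x \<in> S - {\<zero>}"
        using one_not_zero S(1) by (auto simp: subset_iff)
    next
      fix x assume x: "x \<in> S - {\<zero>}"
      then obtain y where "y \<in> S" "y \<otimes> x = \<one>"
        using S_inv by blast
      then show "x \<in> Units (R\<lparr>carrier := S\<rparr>)"
        using x S_comm[of x y] by (auto simp: Units_def)
    qed
    ultimately have "subfield S R"
      by (rule subfieldI)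
    \<comment> \<open>By the tower law the degree 2 of \<open>S\<close> would divide the odd number
      \<open>n\<close>.\<close>
    then obtain a b where ab: "dimension a E S" "n = a * b"
      using subfield_tower[OF E(1) _ ES dim] by metis
    then have "a = 2"
      using dimension_is_inj[OF E(1) _ dimS] by blast
    then show False
      using n ab(2) by simp
  qed
  then show ?thesis
    using ind g(1) unfolding S_def by (intro li_Cons[OF m_closed])
qed

text \<open>The witness is found inside \<open>R\<close> before any splitting is chosen: the cube of
  \<open>g\<close> if \<open>g\<close> is in \<open>E\<close>, and otherwise the constant term of
  the cubic relation of \<open>g\<close> over \<open>E\<close>. So the same \<open>e\<close> works
  for all splittings.\<close>

lemma det_splitting_in_center:
  assumes E: "subfield E R" "centralizer (carrier R) = E"
    and dim: "dimension 9 E (carrier R)" and g: "g \<in> carrier R"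
  shows "\<exists>e\<in>E. \<forall>\<iota> \<phi>. complex_splitting R E 3 \<iota> \<phi> \<longrightarrow> \<iota> e = det (\<phi> g)"
proof (cases "g \<in> E")
  case True
  note Ecs = subringE[OF subfieldE(1)[OF E(1)]]
  have "\<iota> (g \<otimes> (g \<otimes> g)) = det (\<phi> g)" if "complex_splitting R E 3 \<iota> \<phi>" for \<iota> \<phi>
    using complex_splittingD(2,8)[OF that] True Ecs(6)[OF True True] by (simp add: power3_eq_cube)
  then show ?thesis
    using Ecs(6) True by (intro bexI[of _ "g \<otimes> (g \<otimes> g)"]) auto
next
  case False
  have central: "e \<otimes> x = x \<otimes> e" if "e \<in> E" "x \<in> carrier R" for e x
    using that E(2) by (auto simp: centralizer_def)
  have Ec: "e \<in> carrier R" if "e \<in> E" for e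
    using that subfield_zero_one(3)[OF E(1)] by auto
  have ind: "independent E [g \<otimes> g, g, \<one>]"
    using square_not_in_span[OF E(1) central dim _ g False] by simp
  obtain K where K: "g \<in> K" "centralizer K = K"
    using ex_self_centralizing[OF g] .
  note Ks = subringE[OF subfieldE(1)[OF self_centralizing_subfield[OF K(2)]]]
  \<comment> \<open>Three independent elements fill the cubic subfield \<open>K\<close>, which also
    contains the cube of \<open>g\<close>.\<close>
  have "Span E [g \<otimes> g, g, \<one>] = K"
    using independent_length_eq_dimension[OF E(1)
        cubic_self_centralizing_subfield(1)[OF E dim K(2)] ind] K(1) Ks(3,6)
    by simp
  moreover have "g \<otimes> g \<otimes> g \<in> K"
    using K(1) Ks(6) by blast
  ultimately have "g \<otimes> g \<otimes> g \<in> Span E [g \<otimes> g, g, \<one>]"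
    by blast
  then obtain a b e where abe: "a \<in> E" "b \<in> E" "e \<in> E"
    "g \<otimes> g \<otimes> g = a \<otimes> (g \<otimes> g) \<oplus> (b \<otimes> g \<oplus> (e \<otimes> \<one> \<oplus> \<zero>))"
    by (auto simp: line_extension_mem_iff)
  have "\<iota> e = det (\<phi> g)" if split: "complex_splitting R E 3 \<iota> \<phi>" for \<iota> \<phi>
  proof -
    note s = complex_splittingD[OF split]
    have G: "\<phi> g \<in> carrier_mat 3 3" by (rule s(4)[OF g])
    have scal: "\<phi> (e \<otimes> x) = \<iota> e \<cdot>\<^sub>m \<phi> x" if "e \<in> E" "x \<in> carrier R" for e x
      using s(4)[OF that(2)]
      by (simp add: s(6)[OF Ec[OF that(1)] that(2)] s(8)[OF that(1)] mult_smult_assoc_mat[OF one_carrier_mat])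
    have "\<phi> (g \<otimes> g \<otimes> g) = \<phi> g * \<phi> g * \<phi> g"
      using g by (simp add: s(6))
    moreover have "\<phi> (g \<otimes> g \<otimes> g) = \<iota> a \<cdot>\<^sub>m (\<phi> g * \<phi> g) + (\<iota> b \<cdot>\<^sub>m \<phi> g + \<iota> e \<cdot>\<^sub>m 1\<^sub>m 3)"
      unfolding abe(4) using g abe(1-3) Ec
      by (simp add: s(5) s(6)[OF g g] s(8)[OF abe(3)] scal)
    ultimately have cube: "\<phi> g * \<phi> g * \<phi> g = \<iota> a \<cdot>\<^sub>m (\<phi> g * \<phi> g) + (\<iota> b \<cdot>\<^sub>m \<phi> g + \<iota> e \<cdot>\<^sub>m 1\<^sub>m 3)"
      by simp
    obtain t u where ch: "\<And>i j. i < 3 \<Longrightarrow> j < 3 \<Longrightarrow> (\<phi> g * \<phi> g * \<phi> g) $$ (i, j)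
        = t * (\<phi> g * \<phi> g) $$ (i, j) + u * \<phi> g $$ (i, j) + (if i = j then det (\<phi> g) else 0)"
      using cayley_hamilton_3[OF G] by blast
    \<comment> \<open>Differences of the coefficients of the two cubic relations, in the order of
      the list \<open>[g \<otimes> g, g, \<one>]\<close>. Index 2 belongs to the constant
      terms.\<close>
    define w where "w = (!) [\<iota> a - t, \<iota> b - u, \<iota> e - det (\<phi> g)]"
    have "w 2 = 0"
    proof (rule complex_splitting_independent[OF E(1) _ split ind])
      show "dimension (3\<^sup>2) E (carrier R)" using dim by simp
      fix i j :: nat assume ij: "i < 3" "j < 3"
      have "(\<iota> a - t) * (\<phi> g * \<phi> g) $$ (i, j) + (\<iota> b - u) * \<phi> g $$ (i, j)
        + (\<iota> e - det (\<phi> g)) * (if i = j then 1 else 0) = 0"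
        using ch[OF ij] ij G unfolding cube by (simp add: algebra_simps split: if_splits)
      then show "(\<Sum>k<length [g \<otimes> g, g, \<one>]. w k * \<phi> ([g \<otimes> g, g, \<one>] ! k) $$ (i, j)) = 0"
        using ij g by (simp add: w_def lessThan_Suc s(6,7) algebra_simps)
    qed simp
    then show ?thesis by (simp add: w_def)
  qed
  then show ?thesis using abe(3) by blast
qed

end

section \<open>Reduced norms and elements of even order\<close>

text \<open>The given splitting makes the definite description denote: its \<open>\<iota>\<close> is
  injective on \<open>E\<close>, as non-zero elements of \<open>E\<close> have inverses there.
  Without any splitting every element of \<open>E\<close> would qualify.\<close>

lemma (in skew_field) reduced_norm_eq_det:
  assumes E: "subfield E R" "centralizer (carrier R) = E"
    and dim: "dimension 9 E (carrier R)" and g: "g \<in> carrier R"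
    and split: "complex_splitting R E 3 \<iota> \<phi>"
  shows "\<iota> (reduced_norm R E 3 g) = det (\<phi> g)"
proof -
  note Es = subringE[OF subfieldE(1)[OF E(1)]] and s = complex_splittingD[OF split]
  have inj: "x = y" if xy: "x \<in> E" "y \<in> E" "\<iota> x = \<iota> y" for x y
  proof (rule ccontr)
    assume "x \<noteq> y"
    have c: "x \<in> carrier R" "y \<in> carrier R" using xy Es(1) by auto
    have dE: "x \<ominus> y \<in> E"
      using xy Es(5,7) by (simp add: minus_eq)
    have "x = (x \<ominus> y) \<oplus> y"
      using c by (simp add: minus_eq a_assoc l_neg)
    then have "\<iota> x = \<iota> (x \<ominus> y) + \<iota> y"
      using s(1)[OF dE xy(2)] by simp
    then have "\<iota> (x \<ominus> y) = 0"
      using xy(3) by simp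
    moreover have "x \<ominus> y \<in> E - {\<zero>}"
      using dE c \<open>x \<noteq> y\<close> by simp
    ultimately show False
      using subfield_m_inv[OF E(1), of "x \<ominus> y"] s(2)[OF dE, of "inv (x \<ominus> y)"] s(3) by auto
  qed
  obtain e where e: "e \<in> E" "\<And>\<iota> \<phi>. complex_splitting R E 3 \<iota> \<phi> \<Longrightarrow> \<iota> e = det (\<phi> g)"
    using det_splitting_in_center[OF E dim g] by blast
  have "reduced_norm R E 3 g = e"
    unfolding reduced_norm_def
  proof (rule the_equality)
    fix e' assume e': "e' \<in> E \<and> (\<forall>\<iota> \<phi>. complex_splitting R E 3 \<iota> \<phi> \<longrightarrow> \<iota> e' = det (\<phi> g))"
    then have "\<iota> e' = \<iota> e" using split e(2) by metis
    then show "e' = e" using inj e' e(1) by blast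
  qed (use e in blast)
  then show ?thesis using e(2)[OF split] by simp
qed

text \<open>Serves both claims: \<open>m\<close> is half of an even order, or 1 for a
  reflection.\<close>

lemma (in skew_field) power_eq_one_if_square_eq_one:
  assumes E: "subfield E R" "centralizer (carrier R) = E"
    and dim: "dimension 9 E (carrier R)" and g: "g \<in> carrier R"
    and split: "complex_splitting R E 3 \<iota> \<phi>"
    and norm: "reduced_norm R E 3 g = \<one>"
    and sq: "g [^] (m::nat) \<otimes> g [^] m = \<one>"
  shows "g [^] m = \<one>"
proof (rule ccontr)
  assume ne: "g [^] m \<noteq> \<one>"
  note Es = subringE[OF subfieldE(1)[OF E(1)]] and s = complex_splittingD[OF split]
  let ?h = "g [^] m"
  have hc: "?h \<in> carrier R" using g by simp
  have "?h \<otimes> (?h \<oplus> \<one>) = ?h \<oplus> \<one>"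
    using hc sq by (simp add: r_distr a_comm)
  then have "(?h \<ominus> \<one>) \<otimes> (?h \<oplus> \<one>) = \<zero>"
    using hc by (simp add: minus_eq l_distr l_minus r_neg)
  then have "?h \<oplus> \<one> = \<zero>"
    using no_zero_divisors[of "?h \<ominus> \<one>" "?h \<oplus> \<one>"] hc ne by auto
  then have h: "?h = \<ominus> \<one>"
    using hc minus_equality by (metis one_closed)
  \<comment> \<open>Powers are handled through the determinant in one splitting, so multiplicativity
    of the reduced norm itself is never at issue.\<close>
  have det_pow: "det (\<phi> (g [^] (k::nat))) = 1" for k
  proof (induction k)
    case 0
    show ?case by (simp add: s(7))
  next
    case (Suc k)
    have "det (\<phi> g) = 1"
      using reduced_norm_eq_det[OF E dim g split] norm s(3) by simp
    then show ?case
      using Suc g by (simp add: s(6) det_mult[OF s(4) s(4)])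
  qed
  have m1: "\<ominus> \<one> \<in> E" using Es(3,5) by blast
  have "\<iota> \<zero> = 0"
    using s(1)[OF Es(2,2)] by simp
  then have "\<iota> (\<ominus> \<one>) = -1"
    using s(1)[OF Es(3) m1] s(3) by (simp add: r_neg eq_neg_iff_add_eq_0 add.commute)
  \<comment> \<open>The exponent is the degree of the algebra, and its oddness gives the
    contradiction.\<close>
  then have "det (\<phi> (\<ominus> \<one>)) = (-1) ^ 3"
    by (simp add: s(8)[OF m1])
  then show False
    using det_pow[of m] h by simp
qed

text \<open>By the tower law \<open>K\<close> has finite degree over the prime field, so it embeds
  like any number field.\<close>

lemma (in ring) number_subfield_embedding:
  assumes E: "number_subfield E R" and K: "subfield K R" and EK: "E \<subseteq> K" and dim: "dimension n E K"
  obtains j where "j \<in> Ring.ring_hom (R\<lparr>carrier := K\<rparr>) (ring_of_type_algebra :: complex ring)"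
proof -
  obtain q m where q: "q \<in> Ring.ring_hom (ring_of_type_algebra :: rat ring) (R\<lparr>carrier := E\<rparr>)"
    and m: "dimension m (range q) E" and Ef: "subfield E R"
    using E by (auto simp: number_subfield_def finite_dimension_def)
  have qK: "q \<in> Ring.ring_hom (ring_of_type_algebra :: rat ring) (R\<lparr>carrier := K\<rparr>)"
    using q EK by (auto simp: Ring.ring_hom_def)
  have "dimension (m * n) (range q) K"
    using telescopic_base[OF rat_range_subfield(2)[OF ring_axioms Ef q] Ef m dim] .
  then show thesis
    using ex_complex_embedding[OF ring_axioms K qK] that by blast
qed

theorem theorem1p1:
  fixes D :: "('a, 'b) ring_scheme" and E F :: "'a set" and \<alpha> :: "'a \<Rightarrow> 'a"
  assumes "central_division_algebra D E 3"
    and "quadratic_number_field_extension D E F"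
    and "involution_second_kind D E F \<alpha>"
  shows "\<not> (\<exists>g \<in> special_unitary D E 3 \<alpha>. g \<noteq> \<one>\<^bsub>D\<^esub> \<and>
             0 < group.ord (units_of D) g \<and> even (group.ord (units_of D) g))
       \<and> \<not> (\<exists>R \<in> special_unitary D E 3 \<alpha>. R \<noteq> \<one>\<^bsub>D\<^esub> \<and> R \<otimes>\<^bsub>D\<^esub> R = \<one>\<^bsub>D\<^esub>)"
proof -
  interpret skew_field D
    using assms(1) by (simp add: central_division_algebra_def skew_field_def skew_field_axioms_def)
  have E: "subfield E D" "centralizer (carrier D) = E" "dimension 9 E (carrier D)"
    using assms(1) by (auto simp: central_division_algebra_def ring_center_def centralizer_def)
  have nE: "number_subfield E D"
    using assms(2) by (simp add: quadratic_number_field_extension_def)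
  \<comment> \<open>The element \<open>\<one>\<close> is only a seed: every maximal commutative
    subset leads to a splitting.\<close>
  obtain K where K: "centralizer K = K"
    using ex_self_centralizing[OF one_closed] .
  note Kf = self_centralizing_subfield[OF K]
  note cubic = cubic_self_centralizing_subfield[OF E K]
  have EK: "E \<subseteq> K"
    using K E(2) subfield_zero_one(3)[OF Kf] by (auto simp: centralizer_def)
  obtain j where j: "j \<in> Ring.ring_hom (D\<lparr>carrier := K\<rparr>) (ring_of_type_algebra :: complex ring)"
    using number_subfield_embedding[OF nE Kf EK cubic(1)] .
  obtain \<phi> where split: "complex_splitting D E 3 j \<phi>"
    using ex_complex_splitting[OF K cubic(2) j EK] E(2) by (auto simp: centralizer_def)
  have sq: "g [^]\<^bsub>D\<^esub> m = \<one>\<^bsub>D\<^esub>"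
    if "g \<in> special_unitary D E 3 \<alpha>" "g [^]\<^bsub>D\<^esub> m \<otimes>\<^bsub>D\<^esub> g [^]\<^bsub>D\<^esub> m = \<one>\<^bsub>D\<^esub>" for g and m :: nat
    using power_eq_one_if_square_eq_one[OF E _ split _ that(2)] that(1)
    by (auto simp: special_unitary_def Units_def)
  interpret U: group "units_of D"
    by (rule units_group)
  \<comment> \<open>An element of infinite order has \<open>U.ord g = 0\<close>, so positivity
    expresses finite order.\<close>
  have "odd (U.ord g)" if g: "g \<in> special_unitary D E 3 \<alpha>" and ord: "0 < U.ord g" for g
  proof
    assume "even (U.ord g)"
    then obtain m where m: "U.ord g = m + m"
      by (metis evenE mult_2)
    have gU: "g \<in> carrier (units_of D)"
      using g by (simp add: special_unitary_def units_of_carrier)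
    have pow: "g [^]\<^bsub>units_of D\<^esub> k = g [^]\<^bsub>D\<^esub> k" for k :: nat
      using gU units_of_pow by (simp add: units_of_carrier)
    have "g [^]\<^bsub>D\<^esub> (m + m) = \<one>\<^bsub>D\<^esub>"
      using U.pow_ord_eq_1[OF gU] m by (simp add: pow units_of_one)
    then have "g [^]\<^bsub>D\<^esub> m \<otimes>\<^bsub>D\<^esub> g [^]\<^bsub>D\<^esub> m = \<one>\<^bsub>D\<^esub>"
      using g by (simp add: nat_pow_mult special_unitary_def Units_closed)
    then have "g [^]\<^bsub>units_of D\<^esub> m = \<one>\<^bsub>units_of D\<^esub>"
      using sq[OF g] by (simp add: pow units_of_one)
    then have "U.ord g dvd m"
      using U.pow_eq_id[OF gU] by blast
    then show False
      using m ord by (auto dest: dvd_imp_le)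
  qed
  moreover have "x = \<one>\<^bsub>D\<^esub>" if "x \<in> special_unitary D E 3 \<alpha>" "x \<otimes>\<^bsub>D\<^esub> x = \<one>\<^bsub>D\<^esub>" for x
    using sq[OF that(1), of 1] that by (simp add: special_unitary_def Units_closed)
  ultimately show ?thesis
    by blast
qed

end
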